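(* Let $T\subset\mathbb{R}^N$ be a hyperplane, let $\Sigma$ be one of the two open half-spaces bounded by $T$, and let $\tilde{x}$ denote the reflection of $x$ with respect to $T$. Assume that $w\in\mathcal{L}_s(\mathbb{R}^N)\cap C^{1,1}_{loc}(\Sigma)$ is bounded from above and is anti-symmetric, i.e. $w(\tilde{x})=-w(x)$ (in particular $w=0$ on $T$). Suppose that at every point $x\in\Sigma$ with $w(x)>0$, $$(-\Delta+m^2)^s w(x)+c(x)w(x)\le 0,$$ where the function $c$ satisfies $$\inf_{\{x\in\Sigma\,:\,w(x)>0\}}c(x)>-m^{2s}.$$ Then $w(x)\le 0$ for all $x\in\Sigma$. Furthermore, if in addition $(-\Delta+m^2)^s w(x)\le 0$ at every point $x\in\Sigma$ where $w(x)=0$, then either $w<0$ in $\Sigma$ or $w=0$ in $\mathbb{R}^N$.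
   Context: Let $N\ge 1$ be an integer, $0<s<1$, $m>0$. $K_\nu$ is the modified Bessel function of the second kind of order $\nu$, $K_\nu(r)=\int_0^\infty e^{-r\cosh t}\cosh(\nu t)\,dt$ for $r>0$. The operator $(-\Delta+m^2)^s$ is defined by $$(-\Delta+m^2)^s u(x)=c_{N,s}m^{\frac N2+s}\,\mathrm{P.V.}\int_{\mathbb{R}^N}\frac{u(x)-u(y)}{|x-y|^{\frac N2+s}}K_{\frac N2+s}(m|x-y|)\,dy+m^{2s}u(x),\qquad c_{N,s}=2^{1-\frac N2+s}\pi^{-\frac N2}\frac{s(1-s)}{\Gamma(2-s)},$$ where P.V. denotes the Cauchy principal value. The function space is $\mathcal{L}_s(\mathbb{R}^N)=\{u:\mathbb{R}^N\to\mathbb{R}\,:\,\int_{\mathbb{R}^N}\frac{e^{-|x|}|u(x)|}{1+|x|^{\frac{N+1}2+s}}dx<\infty\}$. $C^{1,1}_{loc}$ denotes $C^1$ functions with locally Lipschitz gradient. *)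

theory Defs
  imports "HOL-Analysis.Analysis"
begin

definition bessel_K :: "real \<Rightarrow> real \<Rightarrow> real" where
  "bessel_K \<nu> r = (LINT t:{0..}|lborel. exp (- (r * cosh t)) * cosh (\<nu> * t))"

text \<open>The space \<open>\<real>\<^sup>N\<close> is an arbitrary Euclidean space \<open>'a\<close> with \<open>N = DIM('a)\<close>, so \<open>N \<ge> 1\<close> is
  automatic.\<close>

definition frac_const :: "nat \<Rightarrow> real \<Rightarrow> real" where
  "frac_const N s =
     2 powr (1 - real N / 2 + s) * pi powr (- (real N / 2)) * (s * (1 - s) / Gamma (2 - s))"

definition principal_value :: "'a::euclidean_space \<Rightarrow> ('a \<Rightarrow> real) \<Rightarrow> real" where
  "principal_value x f = Lim (at_right 0) (\<lambda>\<epsilon>. LINT y:(- ball x \<epsilon>)|lebesgue. f y)"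

text \<open>\<open>rel_frac_laplacian m s u x\<close> is \<open>(-\<Delta> + m\<^sup>2)\<^sup>s u(x)\<close>. \<^const>\<open>Lim\<close> and the Lebesgue integral are
  total, so the value is meaningful only where the truncated integrals exist and converge. This is
  the case when \<open>m > 0\<close>, \<open>0 < s < 1\<close>, \<open>u\<close> is measurable and bounded, and \<open>u\<close> is
  \<open>C\<^sup>1\<^sup>,\<^sup>1\<close> near \<open>x\<close>. (For \<open>m < 1\<close>, membership in \<open>weighted_L1\<close> below does not by itself give
  integrability at infinity, since the weight there decays like \<open>e\<^sup>-\<^sup>|\<^sup>x\<^sup>|\<close> independently of \<open>m\<close>.)\<close>

definition rel_frac_laplacian ::
    "real \<Rightarrow> real \<Rightarrow> ('a::euclidean_space \<Rightarrow> real) \<Rightarrow> 'a \<Rightarrow> real" where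
  "rel_frac_laplacian m s u x =
     (let \<nu> = real DIM('a) / 2 + s in
      frac_const DIM('a) s * m powr \<nu> *
        principal_value x
          (\<lambda>y. (u x - u y) / norm (x - y) powr \<nu> * bessel_K \<nu> (m * norm (x - y)))
      + m powr (2 * s) * u x)"

text \<open>The class \<open>\<L>\<^sub>s\<close>. Measurability of \<open>u\<close> has to be required separately, because integrability of
  the weighted \<open>\<bar>u\<bar>\<close> only gives measurability of \<open>\<bar>u\<bar>\<close>.\<close>

definition weighted_L1 :: "real \<Rightarrow> ('a::euclidean_space \<Rightarrow> real) set" where
  "weighted_L1 s =
     {u. u \<in> borel_measurable lebesgue \<and>
         integrable lebesgue
           (\<lambda>x. exp (- norm x) * \<bar>u x\<bar> / (1 + norm x powr ((real DIM('a) + 1) / 2 + s)))}"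

definition C11_loc :: "'a::euclidean_space set \<Rightarrow> ('a \<Rightarrow> real) set" where
  "C11_loc S =
     {u. \<exists>g. (\<forall>x\<in>S. GDERIV u x :> g x) \<and> continuous_on S g \<and>
             (\<forall>x\<in>S. \<exists>r>0. \<exists>L. L-lipschitz_on (ball x r \<inter> S) g)}"

definition reflection :: "'a::euclidean_space set \<Rightarrow> 'a \<Rightarrow> 'a" where
  "reflection T x = 2 *\<^sub>R closest_point T x - x"

lemma reflection_hyperplane:
  fixes a x :: "'a::euclidean_space"
  assumes "a \<noteq> 0"
  shows "reflection {z. a \<bullet> z = b} x = x - (2 * (a \<bullet> x - b) / (a \<bullet> a)) *\<^sub>R a"
proof -
  define k where "k = (a \<bullet> x - b) / (a \<bullet> a)"
  have aa: "a \<bullet> a \<noteq> 0" using assms by simp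
  have k: "k * (a \<bullet> a) = a \<bullet> x - b" using aa by (simp add: k_def)
  define p where "p = x - k *\<^sub>R a"
  have p: "a \<bullet> p = b" using k by (simp add: p_def inner_diff_right)
  have "dist x p \<le> dist x z" if "a \<bullet> z = b" for z
  proof -
    have "\<bar>k\<bar> * norm a * norm a = \<bar>a \<bullet> (x - z)\<bar>"
      using k that by (metis abs_mult abs_norm_cancel inner_diff_right mult.assoc norm_eq_sqrt_inner
          power2_eq_square power2_norm_eq_inner)
    also have "\<dots> \<le> norm a * norm (x - z)" by (rule Cauchy_Schwarz_ineq2)
    finally have "\<bar>k\<bar> * norm a \<le> norm (x - z)" using assms by (simp add: mult.commute)
    then show ?thesis by (simp add: p_def dist_norm)
  qed
  then have "p = closest_point {z. a \<bullet> z = b} x"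
    using closest_point_unique[OF convex_hyperplane closed_hyperplane] p by blast
  then have "reflection {z. a \<bullet> z = b} x = 2 *\<^sub>R p - x" by (simp add: reflection_def)
  also have "\<dots> = x - (2 * k) *\<^sub>R a" by (simp add: p_def algebra_simps scaleR_2)
  finally show ?thesis by (simp add: k_def)
qed

end

theory Submission
  imports Defs
begin

text \<open>
  Write \<open>\<kappa> z\<close> for the kernel \<open>K\<^sub>\<nu>(m|z|) / |z|^\<nu>\<close>, \<open>\<nu> = N/2 + s\<close>, and \<open>\<Sigma>\<close>, \<open>y'\<close> for the
  half-space and the mirror image of \<open>y\<close>. Antisymmetry turns the upper bound on \<open>w\<close> into a bound on \<open>|w|\<close>,
  and it folds the singular integral into the half-space: at \<open>x\<close> in \<open>\<Sigma>\<close> it becomes the integral over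
  \<open>y\<close> in \<open>\<Sigma>\<close> of
  \<open>(w x - w y) (\<kappa>(x - y) - \<kappa>(x - y')) + 2 w(x) \<kappa>(x - y')\<close>.
  The kernel decreases strictly with \<open>|z|\<close> and \<open>x\<close> is closer to \<open>y\<close> than to \<open>y'\<close>, so the bracket
  of kernels is positive. If \<open>w\<close> had a positive maximum over \<open>\<Sigma>\<close> at \<open>x\<close>, both terms would be
  nonnegative, the operator would be at least \<open>m^(2s) w(x)\<close>, and
  the assumption \<open>c > -m^(2s)\<close> would be contradicted.

  The supremum \<open>W\<close> need not be attained: a maximising sequence may run to infinity or into the
  hyperplane, across which \<open>w\<close> may jump. Instead, for a point \<open>x\<^sub>k\<close> with
  \<open>w(x\<^sub>k) > W - \<epsilon>\<close> the function \<open>w - \<epsilon>|y - x\<^sub>k|\<^sup>2/r\<^sup>2\<close> is maximised over the ball of radius \<open>r\<close> about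
  \<open>x\<^sub>k\<close> (\<open>penalised_maximum\<close>). At the maximiser the
  argument above goes through up to an error \<open>\<epsilon> A r^(-2s)\<close> (\<open>principal_value_near_max\<close>). Far from the
  hyperplane \<open>r\<close> is a fixed number and the error is beaten by the uniform gap
  between \<open>c\<close> and \<open>-m^(2s)\<close>. Near the hyperplane \<open>r\<close> is
  half the distance to it, and the error is beaten by the second term
  of the folded integral, because the mass of \<open>\<kappa>(x - y')\<close> over \<open>\<Sigma>\<close> is at least a multiple of
  \<open>r^(-2s)\<close> (\<open>mirror_kernel_mass\<close>). This comparison at equal
  scale needs the sharp two-sided behaviour \<open>\<kappa> z \<approx> |z|^(-N-2s)\<close> near 0, hence the bounds on \<open>K\<^sub>\<nu>\<close>.

  If \<open>w \<le> 0\<close> in \<open>\<Sigma>\<close> and \<open>w(x) = 0\<close> at some \<open>x\<close> in \<open>\<Sigma>\<close>, the folded integral is that of a nonnegative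
  function, whereas the assumption makes it nonpositive; so \<open>w\<close> vanishes
  almost everywhere, and by continuity everywhere, in \<open>\<Sigma>\<close> (\<open>strong_maximum_principle\<close>).

  The operator is defined through a limit that may fail to exist, so the assumptions carry
  information only once the principal value is known to converge. This is where the
  \<open>C\<^sup>1\<^sup>,\<^sup>1\<close> regularity enters: the linear part of \<open>w\<close> at \<open>x\<close> integrates to 0 over every annulus, and
  the quadratic remainder is integrable against \<open>\<kappa>\<close> since \<open>2s < 2\<close>.
\<close>

section \<open>Involutive isometries preserve Lebesgue measure\<close>

text \<open>An isometry maps balls to balls of equal radius, hence of equal volume. By Vitali's theorem
  an open set is, up to a null set, a countable disjoint union of balls, so its preimage has at
  least its measure; applied once more to the preimage, the involution gives the converse
  inequality. This avoids determinants, and covers point reflections and hyperplane reflections in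
  every Euclidean space alike.\<close>
lemma involutive_isometry_distr_lborel:
  fixes \<phi> :: "'a::euclidean_space \<Rightarrow> 'a"
  assumes inv: "\<And>x. \<phi> (\<phi> x) = x" and iso: "\<And>x y. dist (\<phi> x) (\<phi> y) = dist x y"
  shows "distr lborel borel \<phi> = lborel"
proof -
  have cont: "continuous_on UNIV \<phi>"
    using iso by (auto simp: continuous_on_iff)
  have meas [measurable]: "\<phi> \<in> borel_measurable borel"
    using cont by (rule borel_measurable_continuous_onI)
  have ball: "\<phi> -` ball c e = ball (\<phi> c) e" for c e
  proof -
    have "dist c (\<phi> y) = dist (\<phi> c) y" for y
      using iso[of c "\<phi> y"] inv by simp
    then show ?thesis by auto
  qed
  have le: "emeasure lborel S \<le> emeasure lborel (\<phi> -` S)" if "open S" for S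
  proof -
    define K where "K = {(c, e). 0 < e \<and> ball c e \<subseteq> S}"
    have cover: "\<exists>i. i \<in> K \<and> x \<in> ball (fst i) (snd i) \<and> snd i < d" if "x \<in> S" "0 < d" for x d
    proof -
      obtain e where "e > 0" "ball x e \<subseteq> S" using \<open>open S\<close> \<open>x \<in> S\<close> by (meson openE)
      then have "(x, min e (d / 2)) \<in> K" using \<open>0 < d\<close> by (auto simp: K_def)
      then show ?thesis using \<open>0 < d\<close> \<open>e > 0\<close> by (intro exI[of _ "(x, min e (d / 2))"]) auto
    qed
    obtain C where C: "countable C" "C \<subseteq> K"
      "pairwise (\<lambda>i j. disjnt (ball (fst i) (snd i)) (ball (fst j) (snd j))) C"
      "negligible (S - (\<Union>i\<in>C. ball (fst i) (snd i)))"
      by (rule Vitali_covering_theorem_balls[of S K fst snd]) (rule cover)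
    let ?B = "\<lambda>i. ball (fst i) (snd i) :: 'a set"
    have disj: "disjoint_family_on ?B C"
      using C(3) by (auto simp: disjoint_family_on_def pairwise_def disjnt_def)
    have disj': "disjoint_family_on (\<lambda>i. \<phi> -` ?B i) C"
      using disj by (simp add: disjoint_family_on_def flip: vimage_Int)
    have ms [measurable]: "\<phi> -` ?B i \<in> sets borel" for i
      using measurable_sets[OF meas, of "?B i"] by simp
    have Sb [measurable]: "S \<in> sets borel" using that by simp
    have Um: "(\<Union>i\<in>C. ?B i) \<in> sets lborel"
      using C(1) by (intro sets.countable_UN') auto
    have null: "S - (\<Union>i\<in>C. ?B i) \<in> null_sets lborel"
      using C(4) Um Sb by (simp add: negligible_iff_null_sets null_sets_completion_iff sets.Diff)
    have "emeasure lborel S \<le> emeasure lborel ((\<Union>i\<in>C. ?B i) \<union> (S - (\<Union>i\<in>C. ?B i)))"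
      using Um Sb by (intro emeasure_mono) auto
    also have "\<dots> = emeasure lborel (\<Union>i\<in>C. ?B i)"
      using null Um by (intro emeasure_Un_null_set) auto
    also have "\<dots> = (\<integral>\<^sup>+i. emeasure lborel (?B i) \<partial>count_space C)"
      using C(1) disj by (intro emeasure_UN_countable) auto
    also have "\<dots> = (\<integral>\<^sup>+i. emeasure lborel (\<phi> -` ?B i) \<partial>count_space C)"
    proof (intro nn_integral_cong)
      fix i assume "i \<in> space (count_space C)"
      then have "0 \<le> snd i" using C(2) by (auto simp: K_def)
      then show "emeasure lborel (?B i) = emeasure lborel (\<phi> -` ?B i)"
        by (simp add: ball emeasure_ball)
    qed
    also have "\<dots> = emeasure lborel (\<Union>i\<in>C. \<phi> -` ?B i)"
      using C(1) disj' ms by (intro emeasure_UN_countable[symmetric]) auto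
    also have "\<dots> \<le> emeasure lborel (\<phi> -` S)"
    proof (rule emeasure_mono)
      show "(\<Union>i\<in>C. \<phi> -` ?B i) \<subseteq> \<phi> -` S" using C(2) by (fastforce simp: K_def)
      show "\<phi> -` S \<in> sets lborel" using measurable_sets[OF meas Sb] by simp
    qed
    finally show ?thesis .
  qed
  have eq: "emeasure lborel (\<phi> -` S) = emeasure lborel S" if "open S" for S
  proof (rule antisym[OF _ le[OF that]])
    have "open (\<phi> -` S)" using cont that by (simp add: continuous_on_open_vimage)
    from le[OF this] show "emeasure lborel (\<phi> -` S) \<le> emeasure lborel S"
      by (simp add: vimage_def inv)
  qed
  show ?thesis
  proof (rule lborel_eqI[symmetric])
    fix l u :: 'a assume "\<And>b. b \<in> Basis \<Longrightarrow> l \<bullet> b \<le> u \<bullet> b"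
    then show "emeasure (distr lborel borel \<phi>) (box l u) = (\<Prod>b\<in>Basis. (u - l) \<bullet> b)"
      by (simp add: emeasure_distr eq open_box emeasure_lborel_box)
  qed simp
qed

text \<open>The function \<open>w\<close> is merely Lebesgue measurable, so the invariance is needed for the completed
  measure.\<close>
lemma involutive_isometry_distr_lebesgue:
  fixes \<phi> :: "'a::euclidean_space \<Rightarrow> 'a"
  assumes inv: "\<And>x. \<phi> (\<phi> x) = x" and iso: "\<And>x y. dist (\<phi> x) (\<phi> y) = dist x y"
  shows "\<phi> \<in> lebesgue \<rightarrow>\<^sub>M lebesgue" "distr lebesgue lebesgue \<phi> = lebesgue"
proof -
  have "continuous_on UNIV \<phi>"
    using iso by (auto simp: continuous_on_iff)
  then have meas: "\<phi> \<in> lborel \<rightarrow>\<^sub>M lborel"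
    using borel_measurable_continuous_onI by auto
  then have mc: "\<phi> \<in> lebesgue \<rightarrow>\<^sub>M lborel" by (rule measurable_completion)
  have "distr lebesgue lborel \<phi> = distr lborel lborel \<phi>"
    by (rule distr_completion[OF meas])
  also have "\<dots> = distr lborel borel \<phi>" by (rule distr_cong) auto
  also have "\<dots> = lborel" by (rule involutive_isometry_distr_lborel[OF assms])
  finally have d: "distr lebesgue lborel \<phi> = lborel" .
  show "\<phi> \<in> lebesgue \<rightarrow>\<^sub>M lebesgue"
    by (rule completion.measurable_completion2[OF mc]) (simp add: d)
  show "distr lebesgue lebesgue \<phi> = lebesgue"
    using completion.completion_distr_eq[OF mc] by (simp add: d)
qed

lemma involutive_isometry_integral:
  fixes \<phi> :: "'a::euclidean_space \<Rightarrow> 'a" and f :: "'a \<Rightarrow> real"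
  assumes inv: "\<And>x. \<phi> (\<phi> x) = x" and iso: "\<And>x y. dist (\<phi> x) (\<phi> y) = dist x y"
  shows "f \<in> borel_measurable lebesgue \<Longrightarrow> (\<lambda>x. f (\<phi> x)) \<in> borel_measurable lebesgue"
    and "f \<in> borel_measurable lebesgue \<Longrightarrow> integral\<^sup>L lebesgue (\<lambda>x. f (\<phi> x)) = integral\<^sup>L lebesgue f"
    and "integrable lebesgue f \<Longrightarrow> integrable lebesgue (\<lambda>x. f (\<phi> x))"
proof -
  note * = involutive_isometry_distr_lebesgue[OF assms]
  show "f \<in> borel_measurable lebesgue \<Longrightarrow> (\<lambda>x. f (\<phi> x)) \<in> borel_measurable lebesgue"
    using measurable_compose[OF *(1)] .
  show "f \<in> borel_measurable lebesgue \<Longrightarrow> integral\<^sup>L lebesgue (\<lambda>x. f (\<phi> x)) = integral\<^sup>L lebesgue f"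
    using integral_distr[OF *(1), of f] *(2) by simp
  show "integrable lebesgue f \<Longrightarrow> integrable lebesgue (\<lambda>x. f (\<phi> x))"
    using integrable_distr[OF *(1), of f] *(2) by simp
qed

section \<open>A truncated power integral\<close>

lemma real_between_powers_of_2:
  fixes q :: real
  assumes "1 \<le> q"
  obtains n :: nat where "2 ^ n \<le> q" "q \<le> 2 ^ Suc n"
proof -
  define n where "n = nat \<lfloor>log 2 q\<rfloor>"
  have "0 \<le> log 2 q" using assms by simp
  then have n: "real n \<le> log 2 q" "log 2 q \<le> real (Suc n)" unfolding n_def by linarith+
  have "2 ^ n \<le> q" using n(1) assms by (simp add: le_log_iff powr_realpow)
  moreover have "q \<le> 2 ^ Suc n" using n(2) assms by (subst (asm) log_le_iff) (auto simp: powr_realpow simp del: of_nat_Suc power_Suc)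
  ultimately show ?thesis by (rule that)
qed

text \<open>Dyadic decomposition: on the shell \<open>|x - y| \<approx> 2^k r\<close> the integrand is
  at most of order \<open>min 1 4^k (2^k r)^(-N-2s)\<close> and the volume of order \<open>(2^k r)^N\<close>, leaving two geometric
  series, with ratio \<open>2^(2s-2)\<close> inside the ball (this needs \<open>s < 1\<close>) and \<open>2^(-2s)\<close> outside (this needs
  \<open>s > 0\<close>). What matters later is the exact scaling in \<open>r\<close>.\<close>
lemma integral_truncated_power_bound:
  fixes s :: real
  assumes s: "0 < s" "s < 1"
  shows "\<exists>A>0. \<forall>r>0. \<forall>x::'a::euclidean_space.
       (\<integral>\<^sup>+y. ennreal (min 1 ((norm (x - y))\<^sup>2 / r\<^sup>2) * norm (x - y) powr (- (real DIM('a) + 2 * s))) \<partial>lborel)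
         \<le> ennreal (A * r powr (- (2 * s)))"
proof -
  define D where "D = DIM('a)"
  define V where "V = unit_ball_vol (real D)"
  have V: "V > 0" by (simp add: V_def)
  define p where "p = real D + 2 * s"
  have p: "p > 0" using s by (simp add: p_def)
  define \<alpha> where "\<alpha> = 2 powr (2 * s - 2)"
  define \<beta> where "\<beta> = 2 powr (- (2 * s))"
  have \<alpha>: "0 < \<alpha>" "\<alpha> < 1" and \<beta>: "0 < \<beta>" "\<beta> < 1"
    using s by (auto simp: \<alpha>_def \<beta>_def powr_less_one)
  define A where "A = V * 2 powr p * (1 / (1 - \<alpha>)) + V * 2 ^ D * (1 / (1 - \<beta>))"
  have "A > 0" using V \<alpha> \<beta> by (auto simp: A_def intro!: add_pos_pos mult_pos_pos)
  moreover have "(\<integral>\<^sup>+y. ennreal (min 1 ((norm (x - y))\<^sup>2 / r\<^sup>2) * norm (x - y) powr (- p)) \<partial>lborel)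
         \<le> ennreal (A * r powr (- (2 * s)))" if r: "r > 0" for r and x :: 'a
  proof -
    define in_r out_r :: "nat \<Rightarrow> real" where "in_r n = r / 2 ^ n" and "out_r n = r * 2 ^ Suc n" for n
    define u v :: "nat \<Rightarrow> real"
      where "u n = (1 / 4 ^ n) * (r / 2 ^ Suc n) powr (- p)" and "v n = (r * 2 ^ n) powr (- p)" for n
    have [measurable]: "cball x e \<in> sets lborel" for e by simp
    have nn: "0 \<le> u n" "0 \<le> v n" for n by (auto simp: u_def v_def)
    let ?F = "\<lambda>n y. ennreal (u n) * indicator (cball x (in_r n)) y + ennreal (v n) * indicator (cball x (out_r n)) y"
    \<comment> \<open>Each point lies in one dyadic shell, on which a single term of the series
      already dominates the integrand.\<close>
    have pw: "ennreal (min 1 ((norm (x - y))\<^sup>2 / r\<^sup>2) * norm (x - y) powr (- p)) \<le> (\<Sum>n. ?F n y)" (is "?L \<le> _") for y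
    proof -
      define \<rho> where "\<rho> = norm (x - y)"
      have "\<exists>n. ?L \<le> ?F n y" 
      proof (cases "\<rho> = 0 \<or> r \<le> \<rho>")
        case True
        then consider "\<rho> = 0" | "r \<le> \<rho>" by blast
        then show ?thesis
        proof cases
          case 1 then show ?thesis by (simp add: \<rho>_def)
        next
          case 2
          then have "1 \<le> \<rho> / r" using r by simp
          then obtain n where "2 ^ n \<le> \<rho> / r" "\<rho> / r \<le> 2 ^ Suc n" by (rule real_between_powers_of_2)
          then have n: "r * 2 ^ n \<le> \<rho>" "\<rho> \<le> out_r n" using r by (auto simp: field_simps out_r_def)
          have "min 1 (\<rho>\<^sup>2 / r\<^sup>2) * \<rho> powr (- p) \<le> 1 * v n"
            unfolding v_def using n r p by (intro mult_mono powr_mono2') auto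
          moreover have "y \<in> cball x (out_r n)" using n by (simp add: \<rho>_def dist_norm)
          ultimately have "?L \<le> ennreal (v n) * indicator (cball x (out_r n)) y"
            by (simp add: \<rho>_def ennreal_leI)
          then show ?thesis by (intro exI[of _ n]) (simp add: add_increasing)
        qed
      next
        case False
        then have \<rho>: "0 < \<rho>" "\<rho> < r" by (auto simp: \<rho>_def)
        then have "1 \<le> r / \<rho>" by simp
        then obtain n where "2 ^ n \<le> r / \<rho>" "r / \<rho> \<le> 2 ^ Suc n" by (rule real_between_powers_of_2)
        then have n: "r / 2 ^ Suc n \<le> \<rho>" "\<rho> \<le> in_r n" using \<rho> by (auto simp: field_simps in_r_def)
        have "\<rho> / r \<le> 1 / 2 ^ n" using n(2) r by (simp add: in_r_def field_simps)
        then have "(\<rho> / r)\<^sup>2 \<le> (1 / 2 ^ n)\<^sup>2" using \<rho> by (intro power_mono) auto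
        also have "(1 / 2 ^ n)\<^sup>2 = (1 / 4 ^ n :: real)"
          by (simp add: power_one_over power2_eq_square flip: power_mult_distrib)
        finally have "\<rho>\<^sup>2 / r\<^sup>2 \<le> 1 / 4 ^ n" by (simp add: power_divide)
        then have "min 1 (\<rho>\<^sup>2 / r\<^sup>2) * \<rho> powr (- p) \<le> u n"
          unfolding u_def using n r p by (intro mult_mono powr_mono2') auto
        moreover have "y \<in> cball x (in_r n)" using n by (simp add: \<rho>_def dist_norm)
        ultimately have "?L \<le> ennreal (u n) * indicator (cball x (in_r n)) y"
          by (simp add: \<rho>_def ennreal_leI)
        then show ?thesis by (intro exI[of _ n]) (simp add: add_increasing2)
      qed
      then obtain n where "?L \<le> ?F n y" ..
      also have "\<dots> = (\<Sum>k\<in>{n}. ?F k y)" by simp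
      also have "\<dots> \<le> (\<Sum>k. ?F k y)" by (rule sum_le_suminf) auto
      finally show ?thesis .
    qed
    have r_split: "r powr (- p) * r ^ D = r powr (- (2 * s))"
      using r by (simp add: p_def powr_add[symmetric] flip: powr_realpow)
    have un: "u n * (V * in_r n ^ D) = V * 2 powr p * r powr (- (2 * s)) * \<alpha> ^ n" for n
    proof -
      have e1: "(r / 2 ^ Suc n) powr (- p) = r powr (- p) * 2 powr (p * real (Suc n))"
      proof -
        have "(2::real) ^ Suc n = 2 powr real (Suc n)" by (rule powr_realpow[symmetric]) simp
        then have "(r / 2 ^ Suc n) powr (- p) = r powr (- p) / (2 powr real (Suc n)) powr (- p)"
          using r by (simp only: powr_divide)
        also have "\<dots> = r powr (- p) * 2 powr (p * real (Suc n))"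
          unfolding powr_powr by (simp add: powr_minus_divide mult.commute)
        finally show ?thesis .
      qed
      have e2: "in_r n ^ D = r ^ D * 2 powr (- (real D * real n))"
        using r by (simp add: in_r_def power_divide powr_minus powr_realpow[symmetric] powr_powr power_mult field_simps)
      have e3: "1 / 4 ^ n = (2::real) powr (- (2 * real n))"
        by (simp add: powr_minus powr_powr[symmetric] powr_realpow inverse_eq_divide)
      have e4: "\<alpha> ^ n = 2 powr ((2 * s - 2) * real n)"
        by (simp add: \<alpha>_def powr_powr flip: powr_realpow)
      have "u n * (V * in_r n ^ D) = V * (r powr (- p) * r ^ D) *
          (2 powr (- (2 * real n)) * 2 powr (p * real (Suc n)) * 2 powr (- (real D * real n)))"
        unfolding u_def e1 e2 e3 by (simp add: ac_simps)
      also have "2 powr (- (2 * real n)) * 2 powr (p * real (Suc n)) * 2 powr (- (real D * real n)) = 2 powr p * \<alpha> ^ n"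
        unfolding e4 powr_add[symmetric] by (simp add: p_def algebra_simps)
      finally show ?thesis unfolding r_split by (simp add: ac_simps)
    qed
    have vn: "v n * (V * out_r n ^ D) = V * 2 ^ D * r powr (- (2 * s)) * \<beta> ^ n" for n
    proof -
      have e1: "(r * 2 ^ n) powr (- p) = r powr (- p) * 2 powr (- (p * real n))"
        using r by (simp add: powr_mult powr_minus powr_powr field_simps flip: powr_realpow)
      have e2: "out_r n ^ D = r ^ D * 2 ^ D * 2 powr (real D * real n)"
        by (simp add: out_r_def power_mult_distrib powr_realpow[symmetric] powr_powr ac_simps)
      have e4: "\<beta> ^ n = 2 powr (- (2 * s) * real n)"
        by (simp add: \<beta>_def powr_powr flip: powr_realpow)
      have "v n * (V * out_r n ^ D) = V * 2 ^ D * (r powr (- p) * r ^ D) *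
          (2 powr (- (p * real n)) * 2 powr (real D * real n))"
        unfolding v_def e1 e2 by (simp add: ac_simps)
      also have "2 powr (- (p * real n)) * 2 powr (real D * real n) = \<beta> ^ n"
        unfolding e4 powr_add[symmetric] by (simp add: p_def algebra_simps)
      finally show ?thesis unfolding r_split by (simp add: ac_simps)
    qed
    have "(\<integral>\<^sup>+y. ennreal (min 1 ((norm (x - y))\<^sup>2 / r\<^sup>2) * norm (x - y) powr (- p)) \<partial>lborel)
        \<le> (\<integral>\<^sup>+y. (\<Sum>n. ?F n y) \<partial>lborel)"
      by (intro nn_integral_mono pw)
    also have "\<dots> = (\<Sum>n. \<integral>\<^sup>+y. ?F n y \<partial>lborel)"
      by (intro nn_integral_suminf) measurable
    also have "\<dots> = (\<Sum>n. ennreal (u n * (V * in_r n ^ D) + v n * (V * out_r n ^ D)))"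
    proof (intro suminf_cong)
      fix n
      have "0 \<le> in_r n" "0 \<le> out_r n" using r by (auto simp: in_r_def out_r_def)
      then show "(\<integral>\<^sup>+y. ?F n y \<partial>lborel) = ennreal (u n * (V * in_r n ^ D) + v n * (V * out_r n ^ D))"
        using nn V by (subst nn_integral_add)
          (auto simp: nn_integral_cmult_indicator emeasure_cball V_def D_def ennreal_mult'' ennreal_plus)
    qed
    also have "\<dots> = ennreal (A * r powr (- (2 * s)))"
    proof (rule suminf_ennreal_eq)
      show "0 \<le> u n * (V * in_r n ^ D) + v n * (V * out_r n ^ D)" for n
        unfolding un vn using V \<alpha> \<beta> by simp
      show "(\<lambda>n. u n * (V * in_r n ^ D) + v n * (V * out_r n ^ D)) sums (A * r powr (- (2 * s)))"
      proof -
        have "(\<lambda>n. V * 2 powr p * r powr (- (2 * s)) * \<alpha> ^ n + V * 2 ^ D * r powr (- (2 * s)) * \<beta> ^ n)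
          sums (V * 2 powr p * r powr (- (2 * s)) * (1 / (1 - \<alpha>)) + V * 2 ^ D * r powr (- (2 * s)) * (1 / (1 - \<beta>)))"
          using \<alpha> \<beta> by (intro sums_add sums_mult geometric_sums) auto
        then show ?thesis unfolding un vn A_def by (simp add: algebra_simps)
      qed
    qed
    finally show ?thesis .
  qed
  ultimately show ?thesis unfolding p_def D_def by blast
qed

section \<open>Bounds for the modified Bessel function\<close>

lemma half_exp_le_cosh: "exp t / 2 \<le> cosh t" for t :: real
  by (simp add: cosh_def)

lemma cosh_le_exp: "0 \<le> t \<Longrightarrow> cosh t \<le> exp t" for t :: real
proof -
  assume "0 \<le> t"
  then have "exp (- t) \<le> exp t" by simp
  then show ?thesis by (simp add: cosh_def)
qed

lemma integrable_exp_decay: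
  fixes a :: real
  assumes "a > 0"
  shows "integrable lborel (\<lambda>t. indicat_real {0..} t * exp (- a * t))"
proof -
  have "set_integrable lebesgue {0..} (\<lambda>t. exp (- a * t))"
    using assms by (intro nonnegative_absolutely_integrable_1 integrable_on_exp_minus_to_infinity) auto
  then show ?thesis
    by (simp add: set_integrable_def integrable_completion)
qed

text \<open>Up to translation this function dominates the integrand of \<open>K\<^sub>\<nu>(\<rho>)\<close> for every \<open>\<rho>\<close>: by
  \<open>cosh t \<ge> e^t/2\<close>, the argument \<open>\<rho>\<close> only shifts \<open>t\<close> by \<open>ln \<rho>\<close>.\<close>
lemma integrable_double_exp:
  fixes \<nu> :: real
  assumes \<nu>: "\<nu> > 0"
  shows "integrable lborel (\<lambda>t. exp (- (exp t / 2)) * exp (\<nu> * t))"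
proof -
  \<comment> \<open>Any exponent above \<open>\<nu>\<close> would do: \<open>exp (- (exp t / 2))\<close> decays faster than every \<open>exp (- p * t)\<close>.\<close>
  define p where "p = \<nu> + 1"
  define K where "K = exp (p * ln (2 * p))"
  have p: "p > 0" using \<nu> by (simp add: p_def)
  have bound: "exp (- (exp t / 2)) * exp (\<nu> * t) \<le> K * exp (- 1 * t)" for t
  proof -
    have "1 + (t - ln (2 * p)) \<le> exp (t - ln (2 * p))" by (rule exp_ge_add_one_self)
    also have "\<dots> = exp t / (2 * p)" using p by (simp add: exp_diff)
    finally have "p * (1 + (t - ln (2 * p))) \<le> p * (exp t / (2 * p))"
      using p by (intro mult_left_mono) auto
    then have "p * t - exp t / 2 \<le> p * ln (2 * p)" using p by (simp add: algebra_simps)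
    then have "- (exp t / 2) + \<nu> * t \<le> p * ln (2 * p) - t" by (simp add: p_def algebra_simps)
    then have "exp (- (exp t / 2) + \<nu> * t) \<le> exp (p * ln (2 * p) - t)" by simp
    also have "\<dots> = K * exp (- 1 * t)" by (simp add: K_def exp_diff exp_minus field_simps)
    finally show ?thesis by (simp only: exp_add)
  qed
  have i1: "integrable lborel (\<lambda>t. K * (indicat_real {0..} t * exp (- 1 * t)))"
    by (intro integrable_mult_right integrable_exp_decay) auto
  have i2: "integrable lborel (\<lambda>t. indicat_real {0..} (0 + - 1 * t) * exp (- \<nu> * (0 + - 1 * t)))"
    by (intro lborel_integrable_real_affine integrable_exp_decay \<nu>) auto
  show ?thesis
  proof (rule Bochner_Integration.integrable_bound[OF Bochner_Integration.integrable_add[OF i1 i2]])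
    show "AE t in lborel. norm (exp (- (exp t / 2)) * exp (\<nu> * t)) \<le>
       norm (K * (indicat_real {0..} t * exp (- 1 * t)) + indicat_real {0..} (0 + - 1 * t) * exp (- \<nu> * (0 + - 1 * t)))"
    proof (rule AE_I2)
      fix t :: real
      have "exp (- (exp t / 2)) * exp (\<nu> * t) \<le> K * (indicat_real {0..} t * exp (- 1 * t)) + indicat_real {0..} (0 + - 1 * t) * exp (- \<nu> * (0 + - 1 * t))"
      proof (cases "t \<ge> 0")
        case True
        then show ?thesis using bound[of t] by (intro add_increasing2) auto
      next
        case False
        have "exp (- (exp t / 2)) * exp (\<nu> * t) \<le> 1 * exp (\<nu> * t)"
          by (intro mult_right_mono) auto
        then show ?thesis using False by simp
      qed
      then show "norm (exp (- (exp t / 2)) * exp (\<nu> * t)) \<le>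
         norm (K * (indicat_real {0..} t * exp (- 1 * t)) + indicat_real {0..} (0 + - 1 * t) * exp (- \<nu> * (0 + - 1 * t)))"
        by simp
    qed
  qed simp
qed

lemma bessel_integrand_bound:
  fixes \<rho> \<nu> t :: real
  assumes "\<rho> > 0" "t \<ge> 0" "\<nu> > 0"
  shows "exp (- (\<rho> * cosh t)) * cosh (\<nu> * t)
    \<le> \<rho> powr (- \<nu>) * (exp (- (exp (ln \<rho> + 1 * t) / 2)) * exp (\<nu> * (ln \<rho> + 1 * t)))"
proof -
  have "exp (- (\<rho> * cosh t)) * cosh (\<nu> * t) \<le> exp (- (\<rho> * (exp t / 2))) * exp (\<nu> * t)"
    using assms half_exp_le_cosh[of t] by (intro mult_mono cosh_le_exp) auto
  also have "\<dots> = \<rho> powr (- \<nu>) * (exp (- (exp (ln \<rho> + 1 * t) / 2)) * exp (\<nu> * (ln \<rho> + 1 * t)))"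
    using assms by (simp add: powr_def exp_add algebra_simps flip: exp_add) (simp add: exp_add)
  finally show ?thesis .
qed

lemma bessel_integrable:
  fixes \<rho> \<nu> :: real
  assumes "\<rho> > 0" "\<nu> > 0"
  shows "set_integrable lborel {0..} (\<lambda>t. exp (- (\<rho> * cosh t)) * cosh (\<nu> * t))"
  unfolding set_integrable_def
proof (rule Bochner_Integration.integrable_bound)
  show "integrable lborel (\<lambda>t. \<rho> powr (- \<nu>) * (exp (- (exp (ln \<rho> + 1 * t) / 2)) * exp (\<nu> * (ln \<rho> + 1 * t))))"
    by (intro integrable_mult_right lborel_integrable_real_affine[where f="\<lambda>t. exp (- (exp t / 2)) * exp (\<nu> * t)"]
        integrable_double_exp assms) auto
  show "AE t in lborel. norm (indicat_real {0..} t *\<^sub>R (exp (- (\<rho> * cosh t)) * cosh (\<nu> * t)))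
     \<le> norm (\<rho> powr (- \<nu>) * (exp (- (exp (ln \<rho> + 1 * t) / 2)) * exp (\<nu> * (ln \<rho> + 1 * t))))"
    using bessel_integrand_bound[OF assms(1) _ assms(2)]
    by (intro AE_I2) (auto simp: indicator_def abs_mult)
  show "(\<lambda>t. indicat_real {0..} t *\<^sub>R (exp (- (\<rho> * cosh t)) * cosh (\<nu> * t))) \<in> borel_measurable lborel"
    unfolding cosh_def by measurable
qed

text \<open>Shifting \<open>t\<close> by \<open>ln \<rho>\<close> extracts the factor \<open>\<rho>^(-\<nu>)\<close> and leaves an integral independent of \<open>\<rho>\<close>.\<close>
lemma bessel_K_upper:
  assumes \<nu>: "\<nu> > 0"
  obtains C where "C > 0" "\<And>\<rho>. \<rho> > 0 \<Longrightarrow> bessel_K \<nu> \<rho> \<le> C * \<rho> powr (- \<nu>)"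
proof -
  define I where "I = (LINT t|lborel. exp (- (exp t / 2)) * exp (\<nu> * t))"
  have "I \<ge> 0" unfolding I_def by (intro integral_nonneg_AE) auto
  have "bessel_K \<nu> \<rho> \<le> (I + 1) * \<rho> powr (- \<nu>)" if \<rho>: "\<rho> > 0" for \<rho>
  proof -
    have "bessel_K \<nu> \<rho> \<le> (LINT t|lborel. \<rho> powr (- \<nu>) * (exp (- (exp (ln \<rho> + 1 * t) / 2)) * exp (\<nu> * (ln \<rho> + 1 * t))))"
      unfolding bessel_K_def set_lebesgue_integral_def
    proof (rule integral_mono)
      show "integrable lborel (\<lambda>t. indicat_real {0..} t *\<^sub>R (exp (- (\<rho> * cosh t)) * cosh (\<nu> * t)))"
        using bessel_integrable[OF \<rho> \<nu>] by (simp add: set_integrable_def)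
      show "integrable lborel (\<lambda>t. \<rho> powr (- \<nu>) * (exp (- (exp (ln \<rho> + 1 * t) / 2)) * exp (\<nu> * (ln \<rho> + 1 * t))))"
        by (intro integrable_mult_right lborel_integrable_real_affine[where f="\<lambda>t. exp (- (exp t / 2)) * exp (\<nu> * t)"]
        integrable_double_exp assms) auto
      show "indicat_real {0..} t *\<^sub>R (exp (- (\<rho> * cosh t)) * cosh (\<nu> * t))
         \<le> \<rho> powr (- \<nu>) * (exp (- (exp (ln \<rho> + 1 * t) / 2)) * exp (\<nu> * (ln \<rho> + 1 * t)))" for t
        using bessel_integrand_bound[OF \<rho> _ \<nu>, of t] by (auto simp: indicator_def)
    qed
    also have "\<dots> = \<rho> powr (- \<nu>) * I"
      unfolding I_def
      by (subst lborel_integral_real_affine[where c=1 and t="ln \<rho>" and f="\<lambda>t. exp (- (exp t / 2)) * exp (\<nu> * t)"]) auto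
    finally show ?thesis by (simp add: algebra_simps add_increasing)
  qed
  then show ?thesis using \<open>I \<ge> 0\<close> that[of "I + 1"] by auto
qed

text \<open>The integrand is at least this constant on the interval from \<open>\<tau>\<close> to \<open>\<tau> + 1\<close>. The choice
  \<open>\<tau> = 0\<close> gives positivity, \<open>\<tau> = -ln \<rho>\<close> the sharp order \<open>\<rho>^(-\<nu>)\<close> for small \<open>\<rho>\<close>.\<close>
lemma bessel_K_lower:
  assumes \<rho>: "\<rho> > 0" and \<nu>: "\<nu> > 0" and \<tau>: "\<tau> \<ge> 0"
  shows "exp (- (\<rho> * exp (\<tau> + 1))) * exp (\<nu> * \<tau>) / 2 \<le> bessel_K \<nu> \<rho>"
proof -
  let ?c = "exp (- (\<rho> * exp (\<tau> + 1))) * exp (\<nu> * \<tau>) / 2"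
  have "?c = (LINT t|lborel. indicat_real {\<tau>..\<tau>+1} t * ?c)"
    by simp
  also have "\<dots> \<le> bessel_K \<nu> \<rho>"
    unfolding bessel_K_def set_lebesgue_integral_def
  proof (rule integral_mono)
    show "integrable lborel (\<lambda>t. indicat_real {0..} t *\<^sub>R (exp (- (\<rho> * cosh t)) * cosh (\<nu> * t)))"
      using bessel_integrable[OF \<rho> \<nu>] by (simp add: set_integrable_def)
    show "integrable lborel (\<lambda>t. indicat_real {\<tau>..\<tau>+1} t * ?c)" by simp
    fix t :: real
    show "indicat_real {\<tau>..\<tau>+1} t * ?c \<le> indicat_real {0..} t *\<^sub>R (exp (- (\<rho> * cosh t)) * cosh (\<nu> * t))"
    proof (cases "t \<in> {\<tau>..\<tau>+1}")
      case True
      then have t: "\<tau> \<le> t" "t \<le> \<tau> + 1" "0 \<le> t" using \<tau> by auto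
      have "cosh t \<le> exp (\<tau> + 1)" using cosh_le_exp[of t] t by (meson exp_le_cancel_iff order_trans)
      moreover have "exp (\<nu> * \<tau>) / 2 \<le> cosh (\<nu> * t)"
      proof -
        have "exp (\<nu> * \<tau>) \<le> exp (\<nu> * t)" using t \<nu> by simp
        then show ?thesis using half_exp_le_cosh[of "\<nu> * t"] by linarith
      qed
      ultimately have "exp (- (\<rho> * exp (\<tau> + 1))) * (exp (\<nu> * \<tau>) / 2) \<le> exp (- (\<rho> * cosh t)) * cosh (\<nu> * t)"
        using \<rho> by (intro mult_mono) auto
      then show ?thesis using t by simp
    qed (auto simp: indicator_def)
  qed
  finally show ?thesis .
qed

lemma bessel_K_pos: "\<rho> > 0 \<Longrightarrow> \<nu> > 0 \<Longrightarrow> 0 < bessel_K \<nu> \<rho>"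
  using bessel_K_lower[of \<rho> \<nu> 0] by (rule less_le_trans[rotated]) auto

lemma bessel_K_nonneg: "0 \<le> bessel_K \<nu> \<rho>"
  unfolding bessel_K_def set_lebesgue_integral_def by (intro integral_nonneg_AE) auto

lemma bessel_K_antimono:
  assumes "0 < \<rho>" "\<rho> \<le> \<rho>'" "\<nu> > 0"
  shows "bessel_K \<nu> \<rho>' \<le> bessel_K \<nu> \<rho>"
  unfolding bessel_K_def
proof (rule set_integral_mono)
  show "set_integrable lborel {0..} (\<lambda>t. exp (- (\<rho> * cosh t)) * cosh (\<nu> * t))"
    "set_integrable lborel {0..} (\<lambda>t. exp (- (\<rho>' * cosh t)) * cosh (\<nu> * t))"
    using assms by (auto intro!: bessel_integrable)
  show "exp (- (\<rho>' * cosh t)) * cosh (\<nu> * t) \<le> exp (- (\<rho> * cosh t)) * cosh (\<nu> * t)" for t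
    using assms by (intro mult_right_mono) (auto intro!: mult_right_mono)
qed

lemma bessel_K_measurable [measurable]: "bessel_K \<nu> \<in> borel_measurable borel"
  unfolding bessel_K_def[abs_def] set_lebesgue_integral_def cosh_def by measurable

section \<open>The kernel of the operator\<close>

definition rel_kernel :: "real \<Rightarrow> real \<Rightarrow> 'a::euclidean_space \<Rightarrow> real" where
  "rel_kernel m s z = bessel_K (real DIM('a) / 2 + s) (m * norm z) / norm z powr (real DIM('a) / 2 + s)"

lemma rel_kernel_measurable [measurable]: "rel_kernel m s \<in> borel_measurable borel"
  unfolding rel_kernel_def[abs_def] by measurable

lemma rel_kernel_nonneg: "0 \<le> rel_kernel m s z"
  by (simp add: rel_kernel_def bessel_K_nonneg)

lemma rel_kernel_minus: "rel_kernel m s (x - y) = rel_kernel m s (y - x)"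
  by (simp add: rel_kernel_def norm_minus_commute)

text \<open>Strictness comes from the factor \<open>|z|^(-\<nu>)\<close> alone, since \<open>K\<^sub>\<nu>\<close> is positive and nonincreasing. It is
  what makes the strong maximum principle work.\<close>
lemma rel_kernel_strict_antimono:
  fixes z z' :: "'a::euclidean_space"
  assumes "0 < s" "0 < m" "z \<noteq> 0" "norm z < norm z'"
  shows "rel_kernel m s z' < rel_kernel m s z"
proof -
  define \<nu> where "\<nu> = real DIM('a) / 2 + s"
  have \<nu>: "\<nu> > 0" using assms by (auto simp: \<nu>_def intro: add_nonneg_pos)
  have "bessel_K \<nu> (m * norm z') \<le> bessel_K \<nu> (m * norm z)"
    using assms \<nu> by (intro bessel_K_antimono) auto
  moreover have "norm z powr \<nu> < norm z' powr \<nu>" using assms \<nu> by (intro powr_less_mono2) auto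
  moreover have "0 < bessel_K \<nu> (m * norm z)" using assms \<nu> by (intro bessel_K_pos) auto
  moreover have "0 < norm z powr \<nu>" using assms by simp
  moreover from calculation have "0 < norm z' powr \<nu>" by linarith
  ultimately have "bessel_K \<nu> (m * norm z') / norm z' powr \<nu> < bessel_K \<nu> (m * norm z) / norm z powr \<nu>"
    by (intro order.strict_trans1[OF divide_right_mono divide_strict_left_mono]) auto
  then show ?thesis unfolding rel_kernel_def \<nu>_def .
qed

lemma rel_kernel_antimono:
  fixes z z' :: "'a::euclidean_space"
  assumes "0 < s" "0 < m" "z \<noteq> 0" "norm z \<le> norm z'"
  shows "rel_kernel m s z' \<le> rel_kernel m s z"
proof (cases "norm z = norm z'")
  case True then show ?thesis by (simp add: rel_kernel_def)
next
  case False then show ?thesis using rel_kernel_strict_antimono[of s m z z'] assms by simp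
qed

lemma rel_kernel_upper:
  assumes "0 < s" "0 < m"
  shows "\<exists>C>0. \<forall>z::'a::euclidean_space.
    rel_kernel m s z \<le> C * norm z powr (- (real DIM('a) + 2 * s))"
proof -
  define \<nu> where "\<nu> = real DIM('a) / 2 + s"
  have \<nu>: "\<nu> > 0" using assms by (auto simp: \<nu>_def intro: add_nonneg_pos)
  obtain C where C: "C > 0" "\<And>\<rho>. \<rho> > 0 \<Longrightarrow> bessel_K \<nu> \<rho> \<le> C * \<rho> powr (- \<nu>)"
    using bessel_K_upper[OF \<nu>] by blast
  have "rel_kernel m s z \<le> (C * m powr (- \<nu>)) * norm z powr (- (real DIM('a) + 2 * s))" for z :: 'a
  proof (cases "z = 0")
    case False
    have "rel_kernel m s z \<le> C * (m * norm z) powr (- \<nu>) / norm z powr \<nu>"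
      unfolding rel_kernel_def \<nu>_def[symmetric] using False assms by (intro divide_right_mono C(2)) auto
    also have "\<dots> = C * m powr (- \<nu>) * (norm z powr (- \<nu>) * norm z powr (- \<nu>))"
      using assms by (simp add: powr_mult powr_minus_divide)
    also have "norm z powr (- \<nu>) * norm z powr (- \<nu>) = norm z powr (- (real DIM('a) + 2 * s))"
      by (simp add: \<nu>_def flip: powr_add)
    finally show ?thesis .
  qed (simp add: rel_kernel_def)
  then show ?thesis using C(1) assms by (intro exI[of _ "C * m powr (- \<nu>)"]) auto
qed

lemma rel_kernel_lower:
  assumes "0 < s" "0 < m"
  shows "\<exists>c>0. \<forall>z::'a::euclidean_space. m * norm z \<le> 1 \<longrightarrow> c * norm z powr (- (real DIM('a) + 2 * s)) \<le> rel_kernel m s z"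
proof -
  define \<nu> where "\<nu> = real DIM('a) / 2 + s"
  have \<nu>: "\<nu> > 0" using assms by (auto simp: \<nu>_def intro: add_nonneg_pos)
  define c where "c = exp (- exp 1) / 2 * m powr (- \<nu>)"
  have "c * norm z powr (- (real DIM('a) + 2 * s)) \<le> rel_kernel m s z" if "m * norm z \<le> 1" for z :: 'a
  proof (cases "z = 0")
    case False
    define \<rho> where "\<rho> = m * norm z"
    have \<rho>: "0 < \<rho>" "\<rho> \<le> 1" using that False assms by (auto simp: \<rho>_def)
    \<comment> \<open>With \<open>\<tau> = - ln \<rho>\<close> the exponent \<open>\<rho> * exp (\<tau> + 1)\<close> is \<open>exp 1\<close>, whatever \<open>\<rho>\<close> is.\<close>
    have "exp (- exp 1) / 2 * \<rho> powr (- \<nu>) = exp (- (\<rho> * exp (- ln \<rho> + 1))) * exp (\<nu> * (- ln \<rho>)) / 2"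
      using \<rho> by (simp add: powr_def exp_add exp_diff)
    also have "\<dots> \<le> bessel_K \<nu> \<rho>"
      using \<rho> \<nu> by (intro bessel_K_lower) auto
    finally have "exp (- exp 1) / 2 * \<rho> powr (- \<nu>) / norm z powr \<nu> \<le> rel_kernel m s z"
      unfolding rel_kernel_def \<nu>_def[symmetric] \<rho>_def by (intro divide_right_mono) auto
    moreover have "exp (- exp 1) / 2 * \<rho> powr (- \<nu>) / norm z powr \<nu> = c * (norm z powr (- \<nu>) * norm z powr (- \<nu>))"
      using assms by (simp add: c_def \<rho>_def powr_mult powr_minus_divide)
    moreover have "norm z powr (- \<nu>) * norm z powr (- \<nu>) = norm z powr (- (real DIM('a) + 2 * s))"
      by (simp add: \<nu>_def flip: powr_add)
    ultimately show ?thesis by simp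
  qed (simp add: rel_kernel_def)
  moreover have "c > 0" using assms by (simp add: c_def)
  ultimately show ?thesis by blast
qed

text \<open>The convention \<open>x / 0 = 0\<close> makes the kernel 0 at its singularity, so pointwise convergence of the
  truncated integrands holds at that point too.\<close>
lemma rel_kernel_0 [simp]: "rel_kernel m s 0 = 0"
  by (simp add: rel_kernel_def)

lemma rel_kernel_truncated_integral:
  assumes s: "0 < s" "s < 1" and m: "0 < m"
  shows "\<exists>A>0. \<forall>r>0. \<forall>x::'a::euclidean_space.
       integrable lebesgue (\<lambda>y. min 1 ((norm (x - y))\<^sup>2 / r\<^sup>2) * rel_kernel m s (x - y)) \<and>
       (LINT y|lebesgue. min 1 ((norm (x - y))\<^sup>2 / r\<^sup>2) * rel_kernel m s (x - y)) \<le> A * r powr (- (2 * s))"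
proof -
  let ?p = "- (real DIM('a) + 2 * s)"
  obtain A where A: "A > 0"
    "\<And>r (x::'a). r > 0 \<Longrightarrow>
       (\<integral>\<^sup>+y. ennreal (min 1 ((norm (x - y))\<^sup>2 / r\<^sup>2) * norm (x - y) powr ?p) \<partial>lborel) \<le> ennreal (A * r powr (- (2 * s)))"
    using integral_truncated_power_bound[OF s, where 'a='a] by blast
  obtain C where C: "C > 0" "\<And>z::'a. rel_kernel m s z \<le> C * norm z powr ?p"
    using rel_kernel_upper[OF s(1) m, where 'a='a] by blast
  have *: "integrable lebesgue (\<lambda>y. min 1 ((norm (x - y))\<^sup>2 / r\<^sup>2) * rel_kernel m s (x - y)) \<and>
     (LINT y|lebesgue. min 1 ((norm (x - y))\<^sup>2 / r\<^sup>2) * rel_kernel m s (x - y)) \<le> C * A * r powr (- (2 * s))"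
    if r: "r > 0" for r and x :: 'a
  proof -
    let ?f = "\<lambda>y. min 1 ((norm (x - y))\<^sup>2 / r\<^sup>2) * rel_kernel m s (x - y)"
    have [measurable]: "?f \<in> borel_measurable lborel" by measurable
    have nn: "0 \<le> ?f y" for y by (simp add: rel_kernel_nonneg)
    have "(\<integral>\<^sup>+y. ennreal (?f y) \<partial>lborel)
       \<le> (\<integral>\<^sup>+y. ennreal C * ennreal (min 1 ((norm (x - y))\<^sup>2 / r\<^sup>2) * norm (x - y) powr ?p) \<partial>lborel)"
    proof (rule nn_integral_mono)
      fix y
      have "?f y \<le> min 1 ((norm (x - y))\<^sup>2 / r\<^sup>2) * (C * norm (x - y) powr ?p)"
        using C(2)[of "x - y"] by (intro mult_left_mono) auto
      also have "\<dots> = C * (min 1 ((norm (x - y))\<^sup>2 / r\<^sup>2) * norm (x - y) powr ?p)"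
        by simp
      finally have "?f y \<le> C * (min 1 ((norm (x - y))\<^sup>2 / r\<^sup>2) * norm (x - y) powr ?p)" .
      then show "ennreal (?f y) \<le> ennreal C * ennreal (min 1 ((norm (x - y))\<^sup>2 / r\<^sup>2) * norm (x - y) powr ?p)"
        using C(1) by (simp add: ennreal_leI flip: ennreal_mult')
    qed
    also have "\<dots> = ennreal C * (\<integral>\<^sup>+y. ennreal (min 1 ((norm (x - y))\<^sup>2 / r\<^sup>2) * norm (x - y) powr ?p) \<partial>lborel)"
      by (intro nn_integral_cmult) measurable
    also have "\<dots> \<le> ennreal C * ennreal (A * r powr (- (2 * s)))"
      by (intro mult_left_mono A(2) r) auto
    finally have le: "(\<integral>\<^sup>+y. ennreal (?f y) \<partial>lborel) \<le> ennreal (C * A * r powr (- (2 * s)))"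
      using C(1) A(1) by (simp add: ennreal_mult' mult.assoc)
    have int: "integrable lborel ?f"
      using le nn by (intro integrableI_bounded) (auto intro: le_less_trans)
    have "ennreal (integral\<^sup>L lborel ?f) = (\<integral>\<^sup>+y. ennreal (?f y) \<partial>lborel)"
      using nn by (intro nn_integral_eq_integral[symmetric] int) auto
    with le have "ennreal (integral\<^sup>L lborel ?f) \<le> ennreal (C * A * r powr (- (2 * s)))" by simp
    then have "integral\<^sup>L lborel ?f \<le> C * A * r powr (- (2 * s))"
      using C(1) A(1) by (subst (asm) ennreal_le_iff) auto
    then show ?thesis using int by (simp add: integrable_completion integral_completion)
  qed
  have "C * A > 0" using A(1) C(1) by simp
  then show ?thesis using * by blast
qed

section \<open>Existence of the principal value\<close>

context
  fixes m s :: real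
  assumes s: "0 < s" "s < 1" and m: "0 < m"
begin

lemma rel_kernel_truncated_integrable:
  fixes x :: "'a::euclidean_space"
  assumes "r > 0"
  shows "integrable lebesgue (\<lambda>y. min 1 ((norm (x - y))\<^sup>2 / r\<^sup>2) * rel_kernel m s (x - y))"
  using rel_kernel_truncated_integral[OF s m, where 'a='a] by (elim exE conjE) (use assms in simp)

lemma rel_kernel_integrable_off_ball:
  fixes x :: "'a::euclidean_space"
  assumes \<eta>: "\<eta> > 0" and u: "u \<in> borel_measurable lebesgue" and B: "\<And>y. \<bar>u y\<bar> \<le> B"
  shows "set_integrable lebesgue (- ball x \<eta>) (\<lambda>y. u y * rel_kernel m s (x - y))"
  unfolding set_integrable_def
proof (rule Bochner_Integration.integrable_bound)
  show "integrable lebesgue (\<lambda>y. B * (min 1 ((norm (x - y))\<^sup>2 / \<eta>\<^sup>2) * rel_kernel m s (x - y)))"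
    by (intro integrable_mult_right rel_kernel_truncated_integrable \<eta>)
  have [measurable]: "(\<lambda>y. rel_kernel m s (x - y)) \<in> borel_measurable lebesgue"
    by (intro measurable_completion) measurable
  have [measurable]: "ball x \<eta> \<in> sets lebesgue" by simp
  note u[measurable]
  show "(\<lambda>y. indicat_real (- ball x \<eta>) y *\<^sub>R (u y * rel_kernel m s (x - y))) \<in> borel_measurable lebesgue"
    by measurable
  show "AE y in lebesgue. norm (indicat_real (- ball x \<eta>) y *\<^sub>R (u y * rel_kernel m s (x - y)))
      \<le> norm (B * (min 1 ((norm (x - y))\<^sup>2 / \<eta>\<^sup>2) * rel_kernel m s (x - y)))"
  proof (rule AE_I2)
    fix y
    have B0: "0 \<le> B" using B[of y] by linarith
    show "norm (indicat_real (- ball x \<eta>) y *\<^sub>R (u y * rel_kernel m s (x - y)))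
      \<le> norm (B * (min 1 ((norm (x - y))\<^sup>2 / \<eta>\<^sup>2) * rel_kernel m s (x - y)))"
    proof (cases "y \<in> ball x \<eta>")
      case False
      then have "\<eta>\<^sup>2 \<le> (norm (x - y))\<^sup>2" using \<eta> by (intro power_mono) (auto simp: dist_norm)
      then have "min 1 ((norm (x - y))\<^sup>2 / \<eta>\<^sup>2) = 1" using \<eta> by (simp add: field_simps)
      then show ?thesis using False B[of y] B0 by (simp add: abs_mult mult_right_mono)
    qed simp
  qed
qed

text \<open>A bounded function of quadratic order at \<open>x\<close> is dominated by a multiple of \<open>min 1 (|x - y|\<^sup>2 / r\<^sup>2)\<close>, so no
  cancellation is needed for it.\<close>
lemma rel_kernel_integral_off_ball_tendsto:
  fixes x :: "'a::euclidean_space"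
  assumes r: "r > 0" and v: "v \<in> borel_measurable lebesgue" and B: "\<And>y. \<bar>v y\<bar> \<le> B"
    and L: "\<And>y. y \<in> ball x r \<Longrightarrow> \<bar>v y\<bar> \<le> L * (norm (x - y))\<^sup>2"
  shows "((\<lambda>\<eta>. LINT y:- ball x \<eta>|lebesgue. v y * rel_kernel m s (x - y))
     \<longlongrightarrow> (LINT y|lebesgue. v y * rel_kernel m s (x - y))) (at_right 0)"
proof (rule tendsto_at_right_sequentially[of 0 1])
  fix S :: "nat \<Rightarrow> real"
  assume S: "\<And>n. 0 < S n" "\<And>n. S n < 1" "decseq S" "S \<longlonglongrightarrow> 0"
  have [measurable]: "(\<lambda>y. rel_kernel m s (x - y)) \<in> borel_measurable lebesgue"
    by (intro measurable_completion) measurable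
  have [measurable]: "ball x e \<in> sets lebesgue" for e by simp
  note v[measurable]
  define L' where "L' = max L 0"
  have L': "\<bar>v y\<bar> \<le> L' * (norm (x - y))\<^sup>2" if "y \<in> ball x r" for y
    by (rule order_trans[OF L[OF that]]) (auto simp: L'_def intro!: mult_right_mono)
  have "0 \<le> B" using B[of x] by linarith
  have L0: "0 \<le> L'" by (simp add: L'_def)
  have dom: "\<bar>v y\<bar> \<le> (B + L' * r\<^sup>2) * min 1 ((norm (x - y))\<^sup>2 / r\<^sup>2)" for y
  proof (cases "y \<in> ball x r")
    case True
    then have "(norm (x - y))\<^sup>2 \<le> r\<^sup>2" by (intro power_mono) (auto simp: dist_norm)
    then have mn: "min 1 ((norm (x - y))\<^sup>2 / r\<^sup>2) = (norm (x - y))\<^sup>2 / r\<^sup>2" using r by (simp add: field_simps)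
    have "\<bar>v y\<bar> \<le> L' * r\<^sup>2 * ((norm (x - y))\<^sup>2 / r\<^sup>2)" using L'[OF True] r by simp
    also have "\<dots> \<le> (B + L' * r\<^sup>2) * ((norm (x - y))\<^sup>2 / r\<^sup>2)"
      using \<open>0 \<le> B\<close> by (intro mult_right_mono) auto
    finally show ?thesis by (simp only: mn)
  next
    case False
    then have "r\<^sup>2 \<le> (norm (x - y))\<^sup>2" using r by (intro power_mono) (auto simp: dist_norm)
    then have "min 1 ((norm (x - y))\<^sup>2 / r\<^sup>2) = 1" using r by (simp add: field_simps)
    then show ?thesis using B[of y] L0 by (simp add: add_increasing2)
  qed
  show "(\<lambda>n. LINT y:- ball x (S n)|lebesgue. v y * rel_kernel m s (x - y))
     \<longlonglongrightarrow> (LINT y|lebesgue. v y * rel_kernel m s (x - y))"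
    unfolding set_lebesgue_integral_def
  proof (rule integral_dominated_convergence)
    show "integrable lebesgue (\<lambda>y. (B + L' * r\<^sup>2) * (min 1 ((norm (x - y))\<^sup>2 / r\<^sup>2) * rel_kernel m s (x - y)))"
      by (intro integrable_mult_right rel_kernel_truncated_integrable r)
    show "AE y in lebesgue. (\<lambda>n. indicat_real (- ball x (S n)) y *\<^sub>R (v y * rel_kernel m s (x - y)))
        \<longlonglongrightarrow> v y * rel_kernel m s (x - y)"
    proof (rule AE_I2)
      fix y
      show "(\<lambda>n. indicat_real (- ball x (S n)) y *\<^sub>R (v y * rel_kernel m s (x - y)))
        \<longlonglongrightarrow> v y * rel_kernel m s (x - y)"
      proof (cases "y = x")
        case False
        then have "eventually (\<lambda>n. S n < dist x y) sequentially"
          using S(4) by (intro order_tendstoD) auto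
        then have "eventually (\<lambda>n. indicat_real (- ball x (S n)) y *\<^sub>R (v y * rel_kernel m s (x - y))
            = v y * rel_kernel m s (x - y)) sequentially"
          by eventually_elim auto
        then show ?thesis by (rule tendsto_eventually)
      qed simp
    qed
    show "AE y in lebesgue. norm (indicat_real (- ball x (S n)) y *\<^sub>R (v y * rel_kernel m s (x - y)))
       \<le> (B + L' * r\<^sup>2) * (min 1 ((norm (x - y))\<^sup>2 / r\<^sup>2) * rel_kernel m s (x - y))" for n
    proof (rule AE_I2)
      fix y
      have "norm (indicat_real (- ball x (S n)) y *\<^sub>R (v y * rel_kernel m s (x - y)))
         \<le> \<bar>v y\<bar> * rel_kernel m s (x - y)"
        by (auto simp: indicator_def abs_mult rel_kernel_nonneg)
      also have "\<dots> \<le> (B + L' * r\<^sup>2) * min 1 ((norm (x - y))\<^sup>2 / r\<^sup>2) * rel_kernel m s (x - y)"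
        by (intro mult_right_mono dom rel_kernel_nonneg)
      finally show "norm (indicat_real (- ball x (S n)) y *\<^sub>R (v y * rel_kernel m s (x - y)))
       \<le> (B + L' * r\<^sup>2) * (min 1 ((norm (x - y))\<^sup>2 / r\<^sup>2) * rel_kernel m s (x - y))" by (simp only: mult.assoc)
    qed
  qed measurable
qed simp

text \<open>The integrand is odd under the point reflection \<open>y \<mapsto> 2x - y\<close>.\<close>
lemma rel_kernel_linear_part_cancels:
  fixes x p :: "'a::euclidean_space"
  shows "(LINT y:- ball x \<eta>|lebesgue. (indicat_real (ball x r) y * (p \<bullet> (y - x))) * rel_kernel m s (x - y)) = 0"
proof -
  define F where "F y = indicat_real (- ball x \<eta>) y * (indicat_real (ball x r) y * (p \<bullet> (y - x)) * rel_kernel m s (x - y))" for y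
  define \<phi> where "\<phi> y = 2 *\<^sub>R x - y" for y
  have inv: "\<phi> (\<phi> y) = y" for y by (simp add: \<phi>_def)
  have iso: "dist (\<phi> y) (\<phi> z) = dist y z" for y z by (simp add: \<phi>_def dist_norm norm_minus_commute)
  have d: "dist x (\<phi> y) = dist x y" for y
    by (simp add: \<phi>_def dist_norm scaleR_2 norm_minus_commute)
  have xy: "x - \<phi> y = y - x" for y by (simp add: \<phi>_def scaleR_2)
  have yx: "\<phi> y - x = - (y - x)" for y by (simp add: \<phi>_def scaleR_2)
  have odd: "F (\<phi> y) = - F y" for y
    unfolding F_def xy yx inner_minus_right using rel_kernel_minus[of m s y x] d[of y]
    by (simp add: indicator_def)
  have [measurable]: "ball x e \<in> sets lborel" "(\<lambda>y. p \<bullet> (y - x)) \<in> borel_measurable lborel" for e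
    by (auto intro!: borel_measurable_continuous_onI continuous_intros)
  have "F \<in> borel_measurable lebesgue"
    unfolding F_def by (intro measurable_completion) measurable
  then have "integral\<^sup>L lebesgue (\<lambda>y. F (\<phi> y)) = integral\<^sup>L lebesgue F"
    by (rule involutive_isometry_integral(2)[OF inv iso])
  then have "integral\<^sup>L lebesgue F = 0" unfolding odd by simp
  then show ?thesis unfolding set_lebesgue_integral_def F_def by simp
qed

lemma rel_kernel_principal_value_exists:
  fixes x p :: "'a::euclidean_space"
  assumes r: "r > 0" and u: "u \<in> borel_measurable lebesgue" and B: "\<And>y. \<bar>u y\<bar> \<le> B"
    and L: "\<And>y. y \<in> ball x r \<Longrightarrow> \<bar>u x - u y + p \<bullet> (y - x)\<bar> \<le> L * (norm (x - y))\<^sup>2"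
  obtains l where "((\<lambda>\<eta>. LINT y:- ball x \<eta>|lebesgue. (u x - u y) * rel_kernel m s (x - y)) \<longlongrightarrow> l) (at_right 0)"
proof -
  \<comment> \<open>The linear part is cut off at radius \<open>r\<close> to keep it bounded.\<close>
  define lin where "lin y = indicat_real (ball x r) y * (p \<bullet> (y - x))" for y
  define v where "v y = u x - u y + lin y" for y
  note u[measurable]
  have [measurable]: "ball x r \<in> sets lborel" "(\<lambda>y. p \<bullet> (y - x)) \<in> borel_measurable lborel"
    by (auto intro!: borel_measurable_continuous_onI continuous_intros)
  have lin_m [measurable]: "lin \<in> borel_measurable lebesgue"
    unfolding lin_def by (intro measurable_completion) measurable
  have v_m [measurable]: "v \<in> borel_measurable lebesgue" unfolding v_def by measurable
  have lin_b: "\<bar>lin y\<bar> \<le> norm p * r" for y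
  proof (cases "y \<in> ball x r")
    case True
    have "\<bar>p \<bullet> (y - x)\<bar> \<le> norm p * norm (y - x)" by (rule Cauchy_Schwarz_ineq2)
    also have "\<dots> \<le> norm p * r" using True by (intro mult_left_mono) (auto simp: dist_norm norm_minus_commute)
    finally show ?thesis using True by (simp add: lin_def)
  qed (use r in \<open>simp add: lin_def\<close>)
  have v_b: "\<bar>v y\<bar> \<le> 2 * B + norm p * r" for y
    using B[of x] B[of y] lin_b[of y] unfolding v_def by linarith
  have u_b: "\<bar>u x - u y\<bar> \<le> 2 * B" for y
    using B[of x] B[of y] by linarith
  have tend: "((\<lambda>\<eta>. LINT y:- ball x \<eta>|lebesgue. v y * rel_kernel m s (x - y))
     \<longlongrightarrow> (LINT y|lebesgue. v y * rel_kernel m s (x - y))) (at_right 0)"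
    by (rule rel_kernel_integral_off_ball_tendsto[OF r v_m v_b])
      (use L in \<open>auto simp: v_def lin_def\<close>)
  have "(LINT y:- ball x \<eta>|lebesgue. v y * rel_kernel m s (x - y)) =
     (LINT y:- ball x \<eta>|lebesgue. (u x - u y) * rel_kernel m s (x - y))" if "\<eta> > 0" for \<eta>
  proof -
    have "(LINT y:- ball x \<eta>|lebesgue. v y * rel_kernel m s (x - y)) =
       (LINT y:- ball x \<eta>|lebesgue. (u x - u y) * rel_kernel m s (x - y) + lin y * rel_kernel m s (x - y))"
      by (simp add: v_def distrib_right)
    also have "\<dots> = (LINT y:- ball x \<eta>|lebesgue. (u x - u y) * rel_kernel m s (x - y))
        + (LINT y:- ball x \<eta>|lebesgue. lin y * rel_kernel m s (x - y))"
      by (intro set_integral_add rel_kernel_integrable_off_ball[OF that _ u_b] rel_kernel_integrable_off_ball[OF that _ lin_b]) measurable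
    also have "(LINT y:- ball x \<eta>|lebesgue. lin y * rel_kernel m s (x - y)) = 0"
      unfolding lin_def by (rule rel_kernel_linear_part_cancels)
    finally show ?thesis by simp
  qed
  then have "((\<lambda>\<eta>. LINT y:- ball x \<eta>|lebesgue. (u x - u y) * rel_kernel m s (x - y))
     \<longlongrightarrow> (LINT y|lebesgue. v y * rel_kernel m s (x - y))) (at_right 0)"
    by (intro Lim_transform_eventually[OF tend]) (auto simp: eventually_at_right_less intro: eventually_mono[OF eventually_at_right_less])
  then show ?thesis by (rule that)
qed

end

text \<open>Subtracting the linear function with gradient \<open>p = \<nabla>u(x)\<close> leaves a function whose
  gradient is at most \<open>L |x - y|\<close> on the ball of radius \<open>|x - y|\<close>; the mean value
  inequality concludes.\<close>
lemma C11_quadratic_remainder: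
  fixes u :: "'a::euclidean_space \<Rightarrow> real"
  assumes "open S" "u \<in> C11_loc S" "x \<in> S"
  shows "\<exists>p r L. r > 0 \<and> ball x r \<subseteq> S \<and>
    (\<forall>y\<in>ball x r. \<bar>u x - u y + p \<bullet> (y - x)\<bar> \<le> L * (norm (x - y))\<^sup>2)"
proof -
  obtain g where g: "\<forall>x\<in>S. GDERIV u x :> g x"
    "\<forall>x\<in>S. \<exists>r>0. \<exists>L. L-lipschitz_on (ball x r \<inter> S) g"
    using assms(2) by (auto simp: C11_loc_def)
  obtain r1 L where r1: "r1 > 0" "L-lipschitz_on (ball x r1 \<inter> S) g" using g(2) assms(3) by blast
  obtain r2 where r2: "r2 > 0" "ball x r2 \<subseteq> S" using assms(1,3) by (meson openE)
  define r where "r = min r1 r2"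
  have r: "r > 0" "ball x r \<subseteq> S" using r1(1) r2 by (auto simp: r_def)
  have r3: "L-lipschitz_on (ball x r) g"
    by (rule lipschitz_on_subset[OF r1(2)]) (use r2 in \<open>auto simp: r_def\<close>)
  have "\<bar>u x - u y + g x \<bullet> (y - x)\<bar> \<le> L * (norm (x - y))\<^sup>2" if y: "y \<in> ball x r" for y
  proof -
    let ?f = "\<lambda>z. u z - z \<bullet> g x" and ?C = "cball x (norm (x - y))"
    have sub: "?C \<subseteq> ball x r" using y by (auto simp: dist_norm)
    have "norm (?f x - ?f y) \<le> (L * norm (x - y)) * norm (x - y)"
    proof (rule differentiable_bound[of ?C])
      fix z assume z: "z \<in> ?C"
      then have zb: "z \<in> ball x r" using sub by blast
      then have "(u has_derivative (\<lambda>h. h \<bullet> g z)) (at z)" using g(1) r(2) by (auto simp: gderiv_def)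
      then have du: "(u has_derivative (\<lambda>h. h \<bullet> g z)) (at z within ?C)" by (rule has_derivative_at_withinI)
      show "(?f has_derivative (\<lambda>h. h \<bullet> g z - h \<bullet> g x)) (at z within ?C)"
        by (intro has_derivative_diff du has_derivative_inner_left has_derivative_ident)
      have "norm (g z - g x) \<le> L * norm (x - y)"
      proof -
        have "dist (g z) (g x) \<le> L * dist z x" using r3 zb r(1) by (intro lipschitz_onD[OF r3]) auto
        also have "\<dots> \<le> L * norm (x - y)"
          using z lipschitz_on_nonneg[OF r3] by (intro mult_left_mono) (auto simp: dist_commute)
        finally show ?thesis by (simp add: dist_norm)
      qed
      then show "onorm (\<lambda>h. h \<bullet> g z - h \<bullet> g x) \<le> L * norm (x - y)"
        by (intro onorm_le) (auto simp: inner_diff_right[symmetric] mult.commute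
            intro!: order_trans[OF Cauchy_Schwarz_ineq2] mult_left_mono)
    qed (auto simp: dist_norm)
    also have "norm (?f x - ?f y) = \<bar>u x - u y + g x \<bullet> (y - x)\<bar>"
      by (simp add: inner_diff_right inner_commute algebra_simps)
    finally show ?thesis by (simp add: power2_eq_square mult.assoc)
  qed
  with r show ?thesis by blast
qed

lemma continuous_on_C11_loc: "u \<in> C11_loc S \<Longrightarrow> continuous_on S u"
proof (rule continuous_at_imp_continuous_on, rule ballI)
  fix x assume "u \<in> C11_loc S" "x \<in> S"
  then obtain g where "\<forall>x\<in>S. GDERIV u x :> g x" by (auto simp: C11_loc_def)
  with \<open>x \<in> S\<close> have "(u has_derivative (\<lambda>h. h \<bullet> g x)) (at x)" by (auto simp: gderiv_def)
  then show "isCont u x" by (rule has_derivative_continuous)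
qed

section \<open>Reflection at the boundary of a half-space\<close>

text \<open>With a unit normal \<open>a\<close>, the number \<open>a \<bullet> x - b\<close> is the signed distance of \<open>x\<close> to the hyperplane.
  Either side can be obtained by replacing \<open>(a, b)\<close> with \<open>(-a, -b)\<close>.\<close>
locale half_space_mirror =
  fixes a :: "'a::euclidean_space" and b :: real
  assumes unit: "norm a = 1"
begin

definition H :: "'a set" where "H = {y. b < a \<bullet> y}"

definition mirror :: "'a \<Rightarrow> 'a" where "mirror y = y - (2 * (a \<bullet> y - b)) *\<^sub>R a"

lemma inner_aa [simp]: "a \<bullet> a = 1"
  unfolding power2_norm_eq_inner[symmetric] unit by simp

lemma a_nonzero: "a \<noteq> 0"
proof
  assume "a = 0"
  then have "norm a = 0" by (simp only: norm_zero)
  with unit show False by linarith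
qed

lemma inner_mirror: "a \<bullet> mirror y = 2 * b - a \<bullet> y"
  by (simp add: mirror_def inner_diff_right)

lemma mirror_mirror [simp]: "mirror (mirror y) = y"
proof -
  have "mirror (mirror y) = mirror y - (2 * (a \<bullet> mirror y - b)) *\<^sub>R a" by (rule mirror_def)
  also have "\<dots> = y - (2 * (a \<bullet> y - b)) *\<^sub>R a - (2 * (2 * b - a \<bullet> y - b)) *\<^sub>R a"
    unfolding inner_mirror unfolding mirror_def by (rule refl)
  also have "\<dots> = y - (2 * (a \<bullet> y - b) + 2 * (2 * b - a \<bullet> y - b)) *\<^sub>R a"
    by (simp only: scaleR_add_left diff_diff_eq)
  finally show ?thesis by simp
qed

lemma norm_diff_mirror_sq: "(norm (x - mirror y))\<^sup>2 = (norm (x - y))\<^sup>2 + 4 * (a \<bullet> x - b) * (a \<bullet> y - b)"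
proof -
  have *: "(norm (z + k *\<^sub>R a))\<^sup>2 = (norm z)\<^sup>2 + 2 * k * (a \<bullet> z) + k\<^sup>2" for z k
    unfolding power2_norm_eq_inner inner_add_left inner_add_right inner_scaleR_left inner_scaleR_right
      inner_aa inner_commute[of z a] by (simp add: power2_eq_square algebra_simps)
  have "x - mirror y = (x - y) + (2 * (a \<bullet> y - b)) *\<^sub>R a" by (simp add: mirror_def)
  then have "(norm (x - mirror y))\<^sup>2
      = (norm (x - y))\<^sup>2 + 2 * (2 * (a \<bullet> y - b)) * (a \<bullet> (x - y)) + (2 * (a \<bullet> y - b))\<^sup>2"
    by (simp only: *)
  then show ?thesis by (simp add: inner_diff_right power2_eq_square algebra_simps)
qed

lemma dist_mirror: "dist (mirror x) (mirror y) = dist x y"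
proof -
  have "(norm (mirror x - mirror y))\<^sup>2 = (norm (mirror x - y))\<^sup>2 - 4 * (a \<bullet> x - b) * (a \<bullet> y - b)"
    using norm_diff_mirror_sq[of "mirror x" y] by (simp add: inner_mirror algebra_simps)
  also have "(norm (mirror x - y))\<^sup>2 = (norm (x - y))\<^sup>2 + 4 * (a \<bullet> x - b) * (a \<bullet> y - b)"
    using norm_diff_mirror_sq[of y x] norm_minus_commute[of y x] norm_minus_commute[of y "mirror x"]
    by (simp add: algebra_simps)
  finally have "(norm (mirror x - mirror y))\<^sup>2 = (norm (x - y))\<^sup>2" by simp
  then show ?thesis unfolding dist_norm by (rule power2_eq_imp_eq) auto
qed

lemma mirror_measurable [measurable]: "mirror \<in> borel_measurable borel"
  unfolding mirror_def[abs_def] by (intro borel_measurable_continuous_onI continuous_intros)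

lemma open_H: "open H"
  by (simp add: H_def open_halfspace_gt)

lemma mirror_notin_H: "y \<in> H \<Longrightarrow> mirror y \<notin> H"
  by (simp add: H_def inner_mirror)

lemma norm_less_norm_mirror:
  assumes "x \<in> H" "y \<in> H"
  shows "norm (x - y) < norm (x - mirror y)"
proof (rule power2_less_imp_less)
  have "0 < (a \<bullet> x - b) * (a \<bullet> y - b)"
    using assms by (intro mult_pos_pos) (simp_all add: H_def)
  then show "(norm (x - y))\<^sup>2 < (norm (x - mirror y))\<^sup>2"
    unfolding norm_diff_mirror_sq mult.assoc by linarith
qed simp

lemma ball_subset_H: "r \<le> a \<bullet> x - b \<Longrightarrow> ball x r \<subseteq> H"
proof
  fix y assume r: "r \<le> a \<bullet> x - b" and y: "y \<in> ball x r"
  have "\<bar>a \<bullet> (x - y)\<bar> \<le> norm a * norm (x - y)" by (rule Cauchy_Schwarz_ineq2)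
  also have "\<dots> = norm (x - y)" by (simp only: unit mult_1_left)
  also have "\<dots> < r" using y by (simp add: dist_norm)
  finally show "y \<in> H" using r by (simp add: H_def inner_diff_right)
qed

text \<open>The boundary hyperplane is a null set, and the reflection carries the integral over the opposite
  half-space to the half-space.\<close>
lemma integral_fold:
  fixes f :: "'a \<Rightarrow> real"
  assumes f: "integrable lebesgue f"
  shows "integral\<^sup>L lebesgue f = (LINT y|lebesgue. indicat_real H y * (f y + f (mirror y)))"
    and "integrable lebesgue (\<lambda>y. indicat_real H y * (f y + f (mirror y)))"
proof -
  define H' where "H' = {y. a \<bullet> y < b}"
  have H'_mirror: "indicat_real H' (mirror y) = indicat_real H y" for y
    by (simp add: H'_def H_def inner_mirror indicator_def)
  have Hm: "H \<in> sets lebesgue" "H' \<in> sets lebesgue"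
    unfolding H_def H'_def
    by (rule sets_completionI_sets, simp add: open_halfspace_lt open_halfspace_gt)+
  have i1: "integrable lebesgue (\<lambda>y. indicat_real H y * f y)"
    using integrable_mult_indicator[OF Hm(1) f] by simp
  have i2: "integrable lebesgue (\<lambda>y. indicat_real H' y * f y)"
    using integrable_mult_indicator[OF Hm(2) f] by simp
  note inv = involutive_isometry_integral[of mirror, OF mirror_mirror dist_mirror]
  have i3: "integrable lebesgue (\<lambda>y. indicat_real H y * f (mirror y))"
    using inv(3)[OF i2] by (simp add: H'_mirror)
  have "negligible {y. a \<bullet> y = b}"
    by (rule negligible_hyperplane) (simp add: a_nonzero)
  then have ae: "AE y in lebesgue. y \<notin> {y. a \<bullet> y = b}"
    unfolding negligible_iff_null_sets by (rule AE_not_in)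
  have "integral\<^sup>L lebesgue f = (LINT y|lebesgue. indicat_real H y * f y + indicat_real H' y * f y)"
  proof (rule integral_cong_AE)
    have "f y = indicat_real H y * f y + indicat_real H' y * f y" if "a \<bullet> y \<noteq> b" for y
      using that by (cases "a \<bullet> y < b") (simp_all add: H_def H'_def indicator_def)
    with ae show "AE y in lebesgue. f y = indicat_real H y * f y + indicat_real H' y * f y"
      by (auto elim!: eventually_mono)
    show "f \<in> borel_measurable lebesgue" by (rule borel_measurable_integrable[OF f])
    show "(\<lambda>y. indicat_real H y * f y + indicat_real H' y * f y) \<in> borel_measurable lebesgue"
      by (intro borel_measurable_add borel_measurable_integrable i1 i2)
  qed
  also have "\<dots> = (LINT y|lebesgue. indicat_real H y * f y) + (LINT y|lebesgue. indicat_real H' y * f y)"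
    by (rule Bochner_Integration.integral_add[OF i1 i2])
  also have "(LINT y|lebesgue. indicat_real H' y * f y) = (LINT y|lebesgue. indicat_real H y * f (mirror y))"
    using inv(2)[of "\<lambda>y. indicat_real H' y * f y"] i2 by (simp add: H'_mirror)
  also have "(LINT y|lebesgue. indicat_real H y * f y) + (LINT y|lebesgue. indicat_real H y * f (mirror y))
     = (LINT y|lebesgue. indicat_real H y * f y + indicat_real H y * f (mirror y))"
    by (rule Bochner_Integration.integral_add[OF i1 i3, symmetric])
  finally show "integral\<^sup>L lebesgue f = (LINT y|lebesgue. indicat_real H y * (f y + f (mirror y)))"
    by (simp only: distrib_left)
  show "integrable lebesgue (\<lambda>y. indicat_real H y * (f y + f (mirror y)))"
    using Bochner_Integration.integrable_add[OF i1 i3] by (simp only: distrib_left)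
qed

end

section \<open>Folding the singular integral into the half-space\<close>

locale rel_half_space = half_space_mirror +
  fixes m s :: real
  assumes s: "0 < s" "s < 1" and m: "0 < m"
begin

abbreviation \<kappa> :: "'a \<Rightarrow> real" where "\<kappa> \<equiv> rel_kernel m s"

lemma kernel_mirror_less: "x \<in> H \<Longrightarrow> y \<in> H \<Longrightarrow> x \<noteq> y \<Longrightarrow> \<kappa> (x - mirror y) < \<kappa> (x - y)"
  by (rule rel_kernel_strict_antimono[OF s(1) m _ norm_less_norm_mirror]) auto

text \<open>The folding inequality, stated for a function \<open>u\<close> instead of \<open>w x - w y\<close> so that both maximum
  principles can use it. For \<open>y\<close> in the half-space but outside the excised ball,
  \<open>u(y) \<kappa>(x - y) + u(mirror y) \<kappa>(x - mirror y)\<close> is at least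
  \<open>u(y) (\<kappa>(x - y) - \<kappa>(x - mirror y)) + 2 h \<kappa>(x - mirror y) \<ge> 0\<close>. Only the ball of radius \<open>\<eta>\<close> about \<open>x\<close> breaks
  the symmetry, because its mirror image is not excised; this costs the second term on the
  left, which vanishes with \<open>\<eta>\<close>. The larger radius \<open>\<eta>0\<close> makes the main term independent of \<open>\<eta>\<close>.\<close>
lemma folded_lower_bound:
  assumes x: "x \<in> H" and u: "u \<in> borel_measurable lebesgue" and B: "\<And>y. \<bar>u y\<bar> \<le> B"
    and \<eta>: "0 < \<eta>" "\<eta> \<le> \<eta>0" and sub: "ball x \<eta>0 \<subseteq> H"
    and u0: "\<And>y. y \<in> H \<Longrightarrow> 0 \<le> u y" and h: "0 \<le> h"
    and uh: "\<And>y. y \<in> H \<Longrightarrow> 2 * h \<le> u y + u (mirror y)"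
  defines "g \<equiv> \<lambda>y. indicat_real (H - ball x \<eta>0) y * (u y * (\<kappa> (x - y) - \<kappa> (x - mirror y)) + 2 * h * \<kappa> (x - mirror y))"
  shows "integrable lebesgue g"
    and "(LINT y|lebesgue. g y) - B * \<kappa> (\<eta>0 *\<^sub>R a) * measure lebesgue (ball x \<eta>)
       \<le> (LINT y:- ball x \<eta>|lebesgue. u y * \<kappa> (x - y))"
proof -
  note u[measurable]
  have B0: "0 \<le> B" using B[of x] by linarith
  have \<eta>0: "0 < \<eta>0" using \<eta> by linarith
  have [measurable]: "H \<in> sets lebesgue" using open_H by simp
  have [measurable]: "ball x e \<in> sets lebesgue" for e by simp
  have [measurable]: "(\<lambda>y. \<kappa> (x - y)) \<in> borel_measurable lebesgue"
    "(\<lambda>y. \<kappa> (x - mirror y)) \<in> borel_measurable lebesgue"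
    by (intro measurable_completion; measurable)+
  have \<kappa>_le: "\<kappa> (x - mirror y) \<le> \<kappa> (x - y)" if "y \<in> H" "y \<noteq> x" for y
    using kernel_mirror_less[of x y] that x by simp
  have xx: "x \<in> ball x \<eta>0" using \<eta>0 by simp
  show g: "integrable lebesgue g"
  proof (rule Bochner_Integration.integrable_bound)
    show "integrable lebesgue (\<lambda>y. indicat_real (- ball x \<eta>0) y *\<^sub>R ((B + 2 * h) * \<kappa> (x - y)))"
      using rel_kernel_integrable_off_ball[OF s m \<eta>0, of "\<lambda>_. B + 2 * h" "B + 2 * h" x] B0 h
      by (simp add: set_integrable_def)
    show "AE y in lebesgue. norm (g y) \<le> norm (indicat_real (- ball x \<eta>0) y *\<^sub>R ((B + 2 * h) * \<kappa> (x - y)))"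
    proof (rule AE_I2)
      fix y
      show "norm (g y) \<le> norm (indicat_real (- ball x \<eta>0) y *\<^sub>R ((B + 2 * h) * \<kappa> (x - y)))"
      proof (cases "y \<in> H - ball x \<eta>0")
        case True
        then have "y \<in> H" "y \<noteq> x" using xx by auto
        note k = \<kappa>_le[OF this] rel_kernel_nonneg[of m s "x - mirror y"]
        have "u y * (\<kappa> (x - y) - \<kappa> (x - mirror y)) \<le> B * \<kappa> (x - y)"
          using k B[of y] B0 by (intro mult_mono) auto
        moreover have "2 * h * \<kappa> (x - mirror y) \<le> 2 * h * \<kappa> (x - y)"
          using k h by (intro mult_left_mono) auto
        moreover have "0 \<le> u y * (\<kappa> (x - y) - \<kappa> (x - mirror y))"
          using k u0 \<open>y \<in> H\<close> by (intro mult_nonneg_nonneg) auto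
        moreover have "0 \<le> 2 * h * \<kappa> (x - mirror y)" using h k by simp
        ultimately have "norm (g y) \<le> (B + 2 * h) * \<kappa> (x - y)"
          using True by (simp add: g_def distrib_right)
        then show ?thesis using True B0 h k by simp
      qed (simp add: g_def)
    qed
    show "g \<in> borel_measurable lebesgue" unfolding g_def by measurable
  qed
  define f where "f y = indicat_real (- ball x \<eta>) y * (u y * \<kappa> (x - y))" for y
  have f: "integrable lebesgue f"
    using rel_kernel_integrable_off_ball[OF s m \<eta>(1) u B, of x] by (simp add: set_integrable_def f_def[abs_def])
  define e where "e y = indicat_real (ball x \<eta>) y * (B * \<kappa> (\<eta>0 *\<^sub>R a))" for y
  have ball_int: "integrable lebesgue (indicat_real (ball x \<eta>))"
    by (rule integrable_real_indicator) (simp_all add: emeasure_ball \<eta> less_imp_le)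
  have e: "integrable lebesgue e" unfolding e_def
    by (intro integrable_mult_left ball_int)
  have pw: "g y - e y \<le> indicat_real H y * (f y + f (mirror y))" for y
  proof (cases "y \<in> H")
    case False
    moreover have "ball x \<eta> \<subseteq> ball x \<eta>0" using \<eta> by (intro subset_ball)
    ultimately have "y \<notin> ball x \<eta>0" "y \<notin> ball x \<eta>" using sub by blast+
    then show ?thesis using False by (simp add: g_def e_def)
  next
    case True
    have "mirror y \<notin> ball x \<eta>0" using mirror_notin_H[OF True] sub by blast
    then have rb: "mirror y \<notin> ball x \<eta>" "\<eta>0 \<le> norm (x - mirror y)" using \<eta> by (auto simp: dist_norm)
    \<comment> \<open>As \<open>|a| = 1\<close>, the right-hand side is the value of the kernel at distance \<open>\<eta>0\<close>.\<close>
    have far: "\<kappa> (x - mirror y) \<le> \<kappa> (\<eta>0 *\<^sub>R a)"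
    proof (rule rel_kernel_antimono[OF s(1) m])
      show "\<eta>0 *\<^sub>R a \<noteq> 0" using \<eta>0 a_nonzero by simp
      show "norm (\<eta>0 *\<^sub>R a) \<le> norm (x - mirror y)"
        unfolding norm_scaleR unit using rb(2) \<eta>0 by simp
    qed
    note nn = rel_kernel_nonneg[of m s "x - mirror y"]
    show ?thesis
    proof (cases "y \<in> ball x \<eta>")
      case yb: True
      have "- (B * \<kappa> (\<eta>0 *\<^sub>R a)) \<le> u (mirror y) * \<kappa> (x - mirror y)"
      proof -
        have "- u (mirror y) \<le> B" using B[of "mirror y"] by linarith
        then have "- u (mirror y) * \<kappa> (x - mirror y) \<le> B * \<kappa> (x - mirror y)"
          by (intro mult_right_mono nn)
        also have "\<dots> \<le> B * \<kappa> (\<eta>0 *\<^sub>R a)" using far B0 by (intro mult_left_mono)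
        finally show ?thesis by simp
      qed
      then show ?thesis using True yb rb \<eta> by (simp add: g_def e_def f_def)
    next
      case yb: False
      then have "y \<noteq> x" using \<eta> by auto
      note k = \<kappa>_le[OF True this]
      have "(2 * h - u y) * \<kappa> (x - mirror y) \<le> u (mirror y) * \<kappa> (x - mirror y)"
        using uh[OF True] nn by (intro mult_right_mono) auto
      then have 1: "u y * (\<kappa> (x - y) - \<kappa> (x - mirror y)) + 2 * h * \<kappa> (x - mirror y) \<le> f y + f (mirror y)"
        using yb rb by (simp add: f_def algebra_simps)
      have "0 \<le> u y * (\<kappa> (x - y) - \<kappa> (x - mirror y)) + 2 * h * \<kappa> (x - mirror y)"
        using k u0[OF True] h nn by (intro add_nonneg_nonneg mult_nonneg_nonneg) auto
      with 1 show ?thesis using True yb by (auto simp: g_def e_def indicator_def)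
    qed
  qed
  have "(LINT y|lebesgue. g y) - B * \<kappa> (\<eta>0 *\<^sub>R a) * measure lebesgue (ball x \<eta>)
     = (LINT y|lebesgue. g y - e y)"
  proof -
    have "integral\<^sup>L lebesgue e = measure lebesgue (ball x \<eta>) * (B * \<kappa> (\<eta>0 *\<^sub>R a))"
      unfolding e_def by (subst Bochner_Integration.integral_mult_left_zero) simp
    then show ?thesis unfolding Bochner_Integration.integral_diff[OF g e] by (simp add: mult_ac)
  qed
  also have "\<dots> \<le> (LINT y|lebesgue. indicat_real H y * (f y + f (mirror y)))"
    by (intro integral_mono Bochner_Integration.integrable_diff g e integral_fold(2)[OF f] pw)
  also have "\<dots> = (LINT y:- ball x \<eta>|lebesgue. u y * \<kappa> (x - y))"
    unfolding integral_fold(1)[OF f, symmetric] by (simp add: f_def[abs_def] set_lebesgue_integral_def)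
  finally show "(LINT y|lebesgue. g y) - B * \<kappa> (\<eta>0 *\<^sub>R a) * measure lebesgue (ball x \<eta>)
       \<le> (LINT y:- ball x \<eta>|lebesgue. u y * \<kappa> (x - y))" .
qed

text \<open>Letting \<open>\<eta>\<close> tend to 0 removes the error term. The upper bound \<open>F\<close> leaves room for the
  truncated integral of a perturbation of \<open>u\<close>.\<close>
lemma folded_lower_bound_limit:
  assumes x: "x \<in> H" and u: "u \<in> borel_measurable lebesgue" and B: "\<And>y. \<bar>u y\<bar> \<le> B"
    and \<eta>0: "0 < \<eta>0" and sub: "ball x \<eta>0 \<subseteq> H"
    and u0: "\<And>y. y \<in> H \<Longrightarrow> 0 \<le> u y" and h: "0 \<le> h"
    and uh: "\<And>y. y \<in> H \<Longrightarrow> 2 * h \<le> u y + u (mirror y)"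
    and le: "\<And>\<eta>. 0 < \<eta> \<Longrightarrow> \<eta> < \<eta>0 \<Longrightarrow> (LINT y:- ball x \<eta>|lebesgue. u y * \<kappa> (x - y)) \<le> F \<eta>"
    and lim: "(F \<longlongrightarrow> l) (at_right 0)"
  shows "(LINT y|lebesgue. indicat_real (H - ball x \<eta>0) y *
           (u y * (\<kappa> (x - y) - \<kappa> (x - mirror y)) + 2 * h * \<kappa> (x - mirror y))) \<le> l"
    (is "?G \<le> l")
proof (rule tendsto_le[OF _ lim])
  let ?e = "\<lambda>\<eta>. B * \<kappa> (\<eta>0 *\<^sub>R a) * (unit_ball_vol (real DIM('a)) * \<eta> ^ DIM('a))"
  have "((\<lambda>\<eta>. ?G - ?e \<eta>) \<longlongrightarrow> ?G - B * \<kappa> (\<eta>0 *\<^sub>R a) * (unit_ball_vol (real DIM('a)) * 0 ^ DIM('a))) (at_right 0)"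
    by (intro tendsto_intros)
  then show "((\<lambda>\<eta>. ?G - ?e \<eta>) \<longlongrightarrow> ?G) (at_right 0)"
    by (simp add: power_0_left)
  have "eventually (\<lambda>\<eta>. \<eta> \<in> {0<..<\<eta>0}) (at_right 0)"
    using \<eta>0 by (rule eventually_at_right_real)
  then show "eventually (\<lambda>\<eta>. ?G - ?e \<eta> \<le> F \<eta>) (at_right 0)"
  proof eventually_elim
    case (elim \<eta>)
    then have \<eta>: "0 < \<eta>" "\<eta> \<le> \<eta>0" "\<eta> < \<eta>0" by auto
    have "measure lebesgue (ball x \<eta>) = unit_ball_vol (real DIM('a)) * \<eta> ^ DIM('a)"
      using \<eta> by (simp add: content_ball)
    then show ?case
      using folded_lower_bound(2)[OF x u B \<eta>(1,2) sub u0 h uh] le[OF \<eta>(1,3)] by simp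
  qed
qed simp

end

section \<open>The strong maximum principle\<close>

lemma AE_zero_imp_zero_on_open:
  fixes f :: "'a::euclidean_space \<Rightarrow> real"
  assumes S: "open S" and f: "continuous_on S f" and ae: "AE y in lebesgue. y \<in> S \<longrightarrow> f y = 0"
    and y: "y \<in> S"
  shows "f y = 0"
proof (rule ccontr)
  assume "f y \<noteq> 0"
  let ?U = "{z \<in> S. f z \<noteq> 0}"
  have "?U = S \<inter> f -` (- {0})" by auto
  then have "open ?U" using continuous_open_preimage[OF f S, of "- {0}"] by (simp add: open_Compl)
  moreover have "y \<in> ?U" using y \<open>f y \<noteq> 0\<close> by simp
  ultimately obtain e where e: "e > 0" "ball y e \<subseteq> ?U" by (rule openE)
  have "AE z in lebesgue. z \<notin> ball y e"
    using ae
  proof eventually_elim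
    case (elim z)
    then show ?case using e(2) by blast
  qed
  then have "ball y e \<in> null_sets lebesgue"
    by (subst AE_iff_null_sets) simp_all
  then have "measure lebesgue (ball y e) = 0" by (rule measure_eq_0_null_sets)
  then show False using e(1) by (simp add: content_ball_eq_0_iff)
qed

context rel_half_space
begin

text \<open>Folding with \<open>u = -w\<close> and \<open>h = 0\<close> shows that \<open>-w(y) (\<kappa>(x - y) - \<kappa>(x - mirror y))\<close>, which is nonnegative in the
  half-space, has integral at most \<open>l \<le> 0\<close>; its second factor is positive, so \<open>w = 0\<close> almost
  everywhere in the half-space.\<close>
lemma strong_maximum_principle:
  assumes w: "w \<in> borel_measurable lebesgue" and M: "\<And>y. \<bar>w y\<bar> \<le> M"
    and anti: "\<And>y. w (mirror y) = - w y"
    and cont: "continuous_on H w"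
    and le0: "\<And>y. y \<in> H \<Longrightarrow> w y \<le> 0"
    and x: "x \<in> H" "w x = 0"
    and l: "((\<lambda>\<eta>. LINT y:- ball x \<eta>|lebesgue. (w x - w y) * \<kappa> (x - y)) \<longlongrightarrow> l) (at_right 0)"
    and l0: "l \<le> 0"
  shows "w y = 0"
proof -
  define d where "d = a \<bullet> x - b"
  have d: "d > 0" using x(1) by (simp add: d_def H_def)
  define u where "u y = - w y" for y
  have u_m: "u \<in> borel_measurable lebesgue" unfolding u_def using w by measurable
  have u_b: "\<bar>u y\<bar> \<le> M" for y using M[of y] by (simp add: u_def)
  have u0: "0 \<le> u y" if "y \<in> H" for y using le0[OF that] by (simp add: u_def)
  have uh: "2 * 0 \<le> u y + u (mirror y)" if "y \<in> H" for y by (simp add: u_def anti)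
  have vanish: "AE y in lebesgue. y \<in> H - ball x e \<longrightarrow> w y = 0" if e: "0 < e" "e \<le> d" for e
  proof -
    let ?g = "\<lambda>y. indicat_real (H - ball x e) y * (u y * (\<kappa> (x - y) - \<kappa> (x - mirror y)) + 2 * 0 * \<kappa> (x - mirror y))"
    have sub: "ball x e \<subseteq> H" using e by (intro ball_subset_H) (simp add: d_def)
    have int: "integrable lebesgue ?g"
      by (rule folded_lower_bound(1)[OF x(1) u_m u_b e(1) order_refl sub u0 order_refl uh])
    have nn: "0 \<le> ?g y" for y
    proof (cases "y \<in> H - ball x e")
      case True
      then have "y \<in> H" "x \<noteq> y" using e by auto
      then show ?thesis using u0 kernel_mirror_less[OF x(1), of y] True by (simp add: less_imp_le)
    qed simp
    have "(LINT y|lebesgue. ?g y) \<le> l"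
      by (rule folded_lower_bound_limit[OF x(1) u_m u_b e(1) sub u0 order_refl uh _ l])
        (simp_all add: u_def x(2))
    then have "(LINT y|lebesgue. ?g y) \<le> 0" using l0 by linarith
    moreover have "0 \<le> (LINT y|lebesgue. ?g y)" using nn by (intro integral_nonneg_AE) auto
    ultimately have "(LINT y|lebesgue. ?g y) = 0" by linarith
    then have "AE y in lebesgue. ?g y = 0"
      using integral_nonneg_eq_0_iff_AE[OF int] nn by simp
    then show ?thesis
    proof eventually_elim
      case (elim y)
      show ?case
      proof
        assume y: "y \<in> H - ball x e"
        then have "y \<in> H" "x \<noteq> y" using e by auto
        then have "\<kappa> (x - mirror y) < \<kappa> (x - y)" by (intro kernel_mirror_less x(1))
        moreover have "u y * (\<kappa> (x - y) - \<kappa> (x - mirror y)) = 0" using elim y by simp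
        ultimately show "w y = 0" by (simp add: u_def)
      qed
    qed
  qed
  have on_H: "w y = 0" if y: "y \<in> H" for y
  proof (cases "y = x")
    case False
    define e where "e = min d (dist x y / 2)"
    have "0 < dist x y" using False by simp
    then have e: "0 < e" "e \<le> d" "e < dist x y" using d unfolding e_def by linarith+
    \<comment> \<open>Excising a ball around \<open>x\<close> that misses \<open>y\<close> leaves an open set on which \<open>w\<close> vanishes almost everywhere.\<close>
    let ?S = "H - cball x e"
    have "open ?S" using open_H by (intro open_Diff) auto
    moreover have "continuous_on ?S w" by (rule continuous_on_subset[OF cont]) auto
    moreover have "AE z in lebesgue. z \<in> ?S \<longrightarrow> w z = 0"
      using vanish[OF e(1,2)] by eventually_elim auto
    moreover have "y \<in> ?S" using y e by simp
    ultimately show ?thesis by (rule AE_zero_imp_zero_on_open)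
  qed (use x in simp)
  show "w y = 0"
  proof -
    consider "b < a \<bullet> y" | "a \<bullet> y = b" | "a \<bullet> y < b" by linarith
    then show ?thesis
    proof cases
      case 1 then show ?thesis using on_H by (simp add: H_def)
    next
      case 2
      then have "mirror y = y" by (simp add: mirror_def)
      then show ?thesis using anti[of y] by simp
    next
      case 3
      then have "mirror y \<in> H" by (simp add: H_def inner_mirror)
      then have "w (mirror y) = 0" by (rule on_H)
      then show ?thesis using anti[of y] by simp
    qed
  qed
qed

section \<open>The operator at an almost maximal point\<close>

lemma mirror_kernel_integrable:
  assumes x: "x \<in> H" and r: "0 < r"
  shows "integrable lebesgue (\<lambda>y. indicat_real (H - ball x r) y * \<kappa> (x - mirror y))"
proof (rule Bochner_Integration.integrable_bound)
  show "integrable lebesgue (\<lambda>y. indicat_real (- ball x r) y *\<^sub>R (1 * \<kappa> (x - y)))"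
    using rel_kernel_integrable_off_ball[OF s m r, of "\<lambda>_. 1" 1 x] by (simp add: set_integrable_def)
  have [measurable]: "H \<in> sets lebesgue" "ball x r \<in> sets lebesgue" using open_H by simp_all
  have [measurable]: "(\<lambda>y. \<kappa> (x - mirror y)) \<in> borel_measurable lebesgue"
    by (intro measurable_completion) measurable
  show "(\<lambda>y. indicat_real (H - ball x r) y * \<kappa> (x - mirror y)) \<in> borel_measurable lebesgue"
    by measurable
  show "AE y in lebesgue. norm (indicat_real (H - ball x r) y * \<kappa> (x - mirror y))
      \<le> norm (indicat_real (- ball x r) y *\<^sub>R (1 * \<kappa> (x - y)))"
  proof (rule AE_I2)
    fix y
    show "norm (indicat_real (H - ball x r) y * \<kappa> (x - mirror y)) \<le> norm (indicat_real (- ball x r) y *\<^sub>R (1 * \<kappa> (x - y)))"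
    proof (cases "y \<in> H - ball x r")
      case True
      then have "y \<in> H" "x \<noteq> y" using r by auto
      then have "\<kappa> (x - mirror y) \<le> \<kappa> (x - y)" using kernel_mirror_less[OF x] by (simp add: less_imp_le)
      then show ?thesis using True by (simp add: rel_kernel_nonneg)
    qed simp
  qed
qed

text \<open>If the distance of \<open>x\<close> to the hyperplane is comparable to \<open>r\<close>, a ball of radius \<open>r\<close> in the
  half-space has its mirror image at distance at most \<open>9r\<close> from \<open>x\<close>, where the kernel is of order
  \<open>r^(-N-2s)\<close>. This is the gain near the hyperplane, of the same order
  as the loss in \<open>principal_value_near_max\<close>.\<close>
lemma mirror_kernel_mass:
  "\<exists>c>0. \<forall>x r. 0 < r \<longrightarrow> r \<le> a \<bullet> x - b \<longrightarrow> a \<bullet> x - b \<le> 3 * r \<longrightarrow> 9 * m * r \<le> 1 \<longrightarrow>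
     c * r powr (- (2 * s)) \<le> (LINT y|lebesgue. indicat_real (H - ball x r) y * \<kappa> (x - mirror y))"
proof -
  define p where "p = real DIM('a) + 2 * s"
  define V where "V = unit_ball_vol (real DIM('a))"
  have V: "V > 0" by (simp add: V_def)
  have p: "p > 0" using s(1) by (simp add: p_def)
  obtain c where c: "c > 0" "\<forall>z::'a. m * norm z \<le> 1 \<longrightarrow> c * norm z powr (- p) \<le> \<kappa> z"
    using rel_kernel_lower[OF s(1) m, where 'a='a] unfolding p_def by blast
  have "c * V * 9 powr (- p) * r powr (- (2 * s)) \<le> (LINT y|lebesgue. indicat_real (H - ball x r) y * \<kappa> (x - mirror y))"
    if r: "0 < r" "r \<le> a \<bullet> x - b" "a \<bullet> x - b \<le> 3 * r" "9 * m * r \<le> 1" for x r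
  proof -
    have x: "x \<in> H" using r by (simp add: H_def)
    \<comment> \<open>The ball about \<open>z\<close> stays at distance \<open>r\<close> from \<open>x\<close>. Its points have distance at most \<open>3r\<close> from \<open>x\<close> and
      \<open>6r\<close> from the hyperplane, \<open>x\<close> at most \<open>3r\<close> from it, whence the constant \<open>9\<^sup>2 = 3\<^sup>2 + 4 * 3 * 6\<close>.\<close>
    define z where "z = x + (2 * r) *\<^sub>R a"
    have zx: "norm (z - x) = 2 * r" unfolding z_def using unit r(1) by simp
    have az: "a \<bullet> z = a \<bullet> x + 2 * r" by (simp add: z_def inner_add_right)
    define K where "K = c * (9 * r) powr (- p)"
    have K0: "0 \<le> K" using c(1) by (simp add: K_def)
    have pw: "indicat_real (ball z r) y * K \<le> indicat_real (H - ball x r) y * \<kappa> (x - mirror y)" for y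
    proof (cases "y \<in> ball z r")
      case True
      then have yz: "norm (z - y) < r" by (simp add: dist_norm)
      have "\<bar>a \<bullet> (z - y)\<bar> \<le> norm a * norm (z - y)" by (rule Cauchy_Schwarz_ineq2)
      then have "\<bar>a \<bullet> z - a \<bullet> y\<bar> < r" using yz by (simp only: unit mult_1_left inner_diff_right)
      then have ay: "a \<bullet> y - b > 0" "a \<bullet> y - b \<le> 6 * r" using az r by linarith+
      have yH: "y \<in> H" using ay by (simp add: H_def)
      have "norm (z - x) \<le> norm (z - y) + norm (y - x)" "norm (y - x) \<le> norm (y - z) + norm (z - x)"
        by norm+
      then have xy: "r < norm (x - y)" "norm (x - y) \<le> 3 * r"
        using yz zx by (auto simp: norm_minus_commute)
      have "(norm (x - mirror y))\<^sup>2 \<le> (3 * r)\<^sup>2 + 4 * (3 * r) * (6 * r)"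
        unfolding norm_diff_mirror_sq using xy ay r
        by (intro add_mono power_mono mult_mono) auto
      also have "\<dots> = (9 * r)\<^sup>2" by (simp add: power2_eq_square)
      finally have le9: "norm (x - mirror y) \<le> 9 * r" by (rule power2_le_imp_le) (use r(1) in simp)
      have pos: "0 < norm (x - mirror y)"
        using norm_less_norm_mirror[OF x yH] xy r by linarith
      have "m * norm (x - mirror y) \<le> m * (9 * r)" using le9 m by (intro mult_left_mono) auto
      then have "m * norm (x - mirror y) \<le> 1" using r(4) by (simp add: mult_ac)
      then have "c * norm (x - mirror y) powr (- p) \<le> \<kappa> (x - mirror y)" using c(2) by blast
      moreover have "(9 * r) powr (- p) \<le> norm (x - mirror y) powr (- p)"
        using le9 pos p by (intro powr_mono2') auto
      then have "K \<le> c * norm (x - mirror y) powr (- p)"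
        unfolding K_def using c(1) by (intro mult_left_mono) auto
      ultimately have "K \<le> \<kappa> (x - mirror y)" by linarith
      then show ?thesis using True yH xy by (simp add: dist_norm)
    next
      case False
      then show ?thesis by (simp add: rel_kernel_nonneg)
    qed
    have ball_int: "integrable lebesgue (indicat_real (ball z r))"
      using r(1) by (intro integrable_real_indicator) (simp_all add: emeasure_ball)
    have r_split: "(9 * r) powr (- p) * r ^ DIM('a) = 9 powr (- p) * r powr (- (2 * s))"
      using r(1) by (simp add: powr_mult p_def powr_add[symmetric] flip: powr_realpow)
    have "c * V * 9 powr (- p) * r powr (- (2 * s)) = c * V * ((9 * r) powr (- p) * r ^ DIM('a))"
      unfolding r_split by simp
    also have "\<dots> = (V * r ^ DIM('a)) * K" by (simp add: K_def)
    also have "\<dots> = (LINT y|lebesgue. indicat_real (ball z r) y * K)"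
      using r(1) by (subst Bochner_Integration.integral_mult_left_zero) (simp add: content_ball V_def)
    also have "\<dots> \<le> (LINT y|lebesgue. indicat_real (H - ball x r) y * \<kappa> (x - mirror y))"
      using ball_int by (intro integral_mono pw mirror_kernel_integrable x r(1) integrable_mult_left)
    finally show ?thesis .
  qed
  moreover have "c * V * 9 powr (- p) > 0" using c(1) V by simp
  ultimately show ?thesis by blast
qed

text \<open>The function \<open>w\<close> is touched from above at \<open>x\<close> by \<open>w x + \<epsilon> Q\<close>, where \<open>Q\<close> is a paraboloid
  vanishing at \<open>x\<close> inside the ball and 1 outside. Folding applies to
  \<open>u = w x - w + \<epsilon> Q\<close> with \<open>h = w x\<close>; since \<open>Q \<ge> -1\<close> in the half-space and \<open>Q = 1\<close> beyond it, the
  perturbation does not spoil \<open>2 h \<le> u y + u (mirror y)\<close>. The integral of \<open>\<epsilon> Q\<close> itself is at most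
  \<open>\<epsilon> A\<close>, as its linear part cancels.\<close>
lemma principal_value_near_max:
  assumes x: "x \<in> H" and w: "w \<in> borel_measurable lebesgue" and M: "\<And>y. \<bar>w y\<bar> \<le> M"
    and anti: "\<And>y. w (mirror y) = - w y"
    and r: "0 < r" "ball x r \<subseteq> H" and \<epsilon>: "0 \<le> \<epsilon>" and wx: "0 \<le> w x"
    and Q: "\<And>y. y \<in> ball x r \<Longrightarrow> - 1 \<le> (norm (x - y))\<^sup>2 / r\<^sup>2 + p \<bullet> (y - x)"
    and touch: "\<And>y. y \<in> ball x r \<Longrightarrow> w y - w x \<le> \<epsilon> * ((norm (x - y))\<^sup>2 / r\<^sup>2 + p \<bullet> (y - x))"
    and far: "\<And>y. y \<in> H \<Longrightarrow> y \<notin> ball x r \<Longrightarrow> w y - w x \<le> \<epsilon>"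
    and A: "(LINT y|lebesgue. min 1 ((norm (x - y))\<^sup>2 / r\<^sup>2) * \<kappa> (x - y)) \<le> A"
    and l: "((\<lambda>\<eta>. LINT y:- ball x \<eta>|lebesgue. (w x - w y) * \<kappa> (x - y)) \<longlongrightarrow> l) (at_right 0)"
  shows "2 * w x * (LINT y|lebesgue. indicat_real (H - ball x r) y * \<kappa> (x - mirror y)) - \<epsilon> * A \<le> l"
proof -
  note w[measurable]
  define q where "q y = min 1 ((norm (x - y))\<^sup>2 / r\<^sup>2)" for y
  define lin where "lin y = indicat_real (ball x r) y * (p \<bullet> (y - x))" for y
  define u where "u y = w x - w y + \<epsilon> * (q y + lin y)" for y
  have [measurable]: "ball x r \<in> sets lborel" "(\<lambda>y. p \<bullet> (y - x)) \<in> borel_measurable lborel"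
    by (auto intro!: borel_measurable_continuous_onI continuous_intros)
  have lin_m [measurable]: "lin \<in> borel_measurable lebesgue"
    unfolding lin_def by (intro measurable_completion) measurable
  have q_m [measurable]: "q \<in> borel_measurable lebesgue"
    unfolding q_def by (intro measurable_completion) measurable
  have u_m [measurable]: "u \<in> borel_measurable lebesgue" unfolding u_def by measurable
  have q_in: "q y = (norm (x - y))\<^sup>2 / r\<^sup>2" if "y \<in> ball x r" for y
  proof -
    have "(norm (x - y))\<^sup>2 \<le> r\<^sup>2" using that by (intro power_mono) (auto simp: dist_norm)
    then show ?thesis using r(1) by (simp add: q_def field_simps)
  qed
  have q_out: "q y = 1" if "y \<notin> ball x r" for y
  proof -
    have "r\<^sup>2 \<le> (norm (x - y))\<^sup>2" using that r(1) by (intro power_mono) (auto simp: dist_norm)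
    then show ?thesis using r(1) by (simp add: q_def field_simps)
  qed
  have q_b: "\<bar>q y\<bar> \<le> 1" for y by (simp add: q_def)
  have lin_b: "\<bar>lin y\<bar> \<le> norm p * r" for y
  proof (cases "y \<in> ball x r")
    case True
    have "\<bar>p \<bullet> (y - x)\<bar> \<le> norm p * norm (y - x)" by (rule Cauchy_Schwarz_ineq2)
    also have "\<dots> \<le> norm p * r" using True by (intro mult_left_mono) (auto simp: dist_norm norm_minus_commute)
    finally show ?thesis using True by (simp add: lin_def)
  qed (use r(1) in \<open>simp add: lin_def\<close>)
  have d_b: "\<bar>w x - w y\<bar> \<le> 2 * M" for y using M[of x] M[of y] by linarith
  have u_b: "\<bar>u y\<bar> \<le> 2 * M + \<epsilon> * (1 + norm p * r)" for y
  proof -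
    have "\<bar>\<epsilon> * (q y + lin y)\<bar> \<le> \<epsilon> * (1 + norm p * r)"
      unfolding abs_mult using \<epsilon> q_b[of y] lin_b[of y] by (intro mult_mono) auto
    then show ?thesis using d_b[of y] unfolding u_def by linarith
  qed
  have ql_lower: "- 1 \<le> q y + lin y" for y
    using Q[of y] q_in[of y] q_out[of y] by (cases "y \<in> ball x r") (auto simp: lin_def)
  have u_nonneg: "0 \<le> u y" if "y \<in> H" for y
    using that touch[of y] far[of y] q_in[of y] q_out[of y]
    by (cases "y \<in> ball x r") (auto simp: u_def lin_def)
  have u_sym: "2 * w x \<le> u y + u (mirror y)" if "y \<in> H" for y
  proof -
    have "mirror y \<notin> ball x r" using mirror_notin_H[OF that] r(2) by blast
    then have "u (mirror y) = w x + w y + \<epsilon>" by (simp add: u_def anti q_out lin_def)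
    then have "u y + u (mirror y) = 2 * w x + \<epsilon> * (q y + lin y + 1)" by (simp add: u_def algebra_simps)
    moreover have "0 \<le> \<epsilon> * (q y + lin y + 1)" using \<epsilon> ql_lower[of y] by (intro mult_nonneg_nonneg) auto
    ultimately show ?thesis by linarith
  qed
  have q_int: "integrable lebesgue (\<lambda>y. q y * \<kappa> (x - y))"
    unfolding q_def by (rule rel_kernel_truncated_integrable[OF s m r(1)])
  have le: "(LINT y:- ball x \<eta>|lebesgue. u y * \<kappa> (x - y))
     \<le> (LINT y:- ball x \<eta>|lebesgue. (w x - w y) * \<kappa> (x - y)) + \<epsilon> * A" if \<eta>: "0 < \<eta>" for \<eta>
  proof -
    have dm: "(\<lambda>y. w x - w y) \<in> borel_measurable lebesgue" by measurable
    note i1 = rel_kernel_integrable_off_ball[OF s m \<eta> dm d_b]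
    note i2 = rel_kernel_integrable_off_ball[OF s m \<eta> q_m q_b, of x]
    note i3 = rel_kernel_integrable_off_ball[OF s m \<eta> lin_m lin_b, of x]
    have "(LINT y:- ball x \<eta>|lebesgue. u y * \<kappa> (x - y)) =
      (LINT y:- ball x \<eta>|lebesgue. (w x - w y) * \<kappa> (x - y) + (\<epsilon> * (q y * \<kappa> (x - y)) + \<epsilon> * (lin y * \<kappa> (x - y))))"
      by (simp add: u_def algebra_simps)
    also have "\<dots> = (LINT y:- ball x \<eta>|lebesgue. (w x - w y) * \<kappa> (x - y)) +
        (\<epsilon> * (LINT y:- ball x \<eta>|lebesgue. q y * \<kappa> (x - y)) + \<epsilon> * (LINT y:- ball x \<eta>|lebesgue. lin y * \<kappa> (x - y)))"
      using i1 i2 i3 by (simp add: set_integral_add)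
    also have "(LINT y:- ball x \<eta>|lebesgue. lin y * \<kappa> (x - y)) = 0"
      unfolding lin_def by (rule rel_kernel_linear_part_cancels[OF s m])
    also have "(LINT y:- ball x \<eta>|lebesgue. q y * \<kappa> (x - y)) \<le> (LINT y|lebesgue. q y * \<kappa> (x - y))"
      unfolding set_lebesgue_integral_def
    proof (rule integral_mono)
      show "integrable lebesgue (\<lambda>y. indicat_real (- ball x \<eta>) y *\<^sub>R (q y * \<kappa> (x - y)))"
        using i2 unfolding set_integrable_def .
      show "indicat_real (- ball x \<eta>) y *\<^sub>R (q y * \<kappa> (x - y)) \<le> q y * \<kappa> (x - y)" for y
        by (auto simp: indicator_def q_def rel_kernel_nonneg)
    qed (rule q_int)
    also have "\<dots> \<le> A" using A unfolding q_def .
    finally show ?thesis using \<epsilon> by (simp add: mult_left_mono)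
  qed
  have lim: "((\<lambda>\<eta>. (LINT y:- ball x \<eta>|lebesgue. (w x - w y) * \<kappa> (x - y)) + \<epsilon> * A) \<longlongrightarrow> l + \<epsilon> * A) (at_right 0)"
    by (intro tendsto_intros l)
  let ?g = "\<lambda>y. indicat_real (H - ball x r) y * (u y * (\<kappa> (x - y) - \<kappa> (x - mirror y)) + 2 * w x * \<kappa> (x - mirror y))"
  have "2 * w x * (LINT y|lebesgue. indicat_real (H - ball x r) y * \<kappa> (x - mirror y))
     = (LINT y|lebesgue. 2 * w x * (indicat_real (H - ball x r) y * \<kappa> (x - mirror y)))"
    by simp
  also have "\<dots> \<le> (LINT y|lebesgue. ?g y)"
  proof (rule integral_mono)
    show "integrable lebesgue (\<lambda>y. 2 * w x * (indicat_real (H - ball x r) y * \<kappa> (x - mirror y)))"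
      by (intro integrable_mult_right mirror_kernel_integrable x r(1))
    show "integrable lebesgue ?g"
      by (rule folded_lower_bound(1)[OF x u_m u_b r(1) order_refl r(2) u_nonneg wx u_sym])
    fix y
    show "2 * w x * (indicat_real (H - ball x r) y * \<kappa> (x - mirror y)) \<le> ?g y"
    proof (cases "y \<in> H - ball x r")
      case True
      then have yH: "y \<in> H" "x \<noteq> y" using r(1) by auto
      have "0 \<le> u y * (\<kappa> (x - y) - \<kappa> (x - mirror y))"
        using u_nonneg[OF yH(1)] kernel_mirror_less[OF x yH] by (intro mult_nonneg_nonneg) auto
      then show ?thesis using True by simp
    qed simp
  qed
  also have "\<dots> \<le> l + \<epsilon> * A"
    by (rule folded_lower_bound_limit[OF x u_m u_b r u_nonneg wx u_sym le lim])
  finally show ?thesis by linarith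
qed

section \<open>The weak maximum principle\<close>

text \<open>The penalty is 0 at \<open>xk\<close> and \<open>\<epsilon>\<close> on the boundary of the ball, and \<open>w xk\<close> is within \<open>\<epsilon>\<close> of the upper bound \<open>W\<close>; so the
  maximiser lies inside the ball, and its inequality extends
  from that ball to the whole half-space. Completing the square at the
  maximiser \<open>x\<close> turns the penalty into a paraboloid through \<open>x\<close> with linear part \<open>p\<close>.\<close>
lemma penalised_maximum:
  assumes cont: "continuous_on H w" and le_W: "\<forall>y\<in>H. w y \<le> W"
    and xk: "xk \<in> H" "W - \<epsilon> < w xk" and \<epsilon>: "0 < \<epsilon>"
    and r: "0 < r" "2 * r \<le> a \<bullet> xk - b"
  shows "\<exists>x p. W - \<epsilon> < w x \<and> norm (x - xk) < r \<and> ball x r \<subseteq> H \<and>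
    (\<forall>y\<in>ball x r. - 1 \<le> (norm (x - y))\<^sup>2 / r\<^sup>2 + p \<bullet> (y - x)) \<and>
    (\<forall>y\<in>ball x r. w y - w x \<le> \<epsilon> * ((norm (x - y))\<^sup>2 / r\<^sup>2 + p \<bullet> (y - x))) \<and>
    (\<forall>y\<in>H. w y - w x \<le> \<epsilon>)"
proof -
  note W = le_W[rule_format]
  define q where "q y = (norm (y - xk))\<^sup>2 / r\<^sup>2" for y
  define f where "f y = w y - \<epsilon> * q y" for y
  have "cball xk r \<subseteq> ball xk (a \<bullet> xk - b)" using r by auto
  also have "\<dots> \<subseteq> H" by (rule ball_subset_H) simp
  finally have sub: "cball xk r \<subseteq> H" .
  have "continuous_on (cball xk r) f"
    unfolding f_def q_def by (intro continuous_intros continuous_on_subset[OF cont sub]) (use r in auto)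
  then obtain x where x: "x \<in> cball xk r" "\<And>y. y \<in> cball xk r \<Longrightarrow> f y \<le> f x"
    using continuous_attains_sup[of "cball xk r" f] r by auto
  have xH: "x \<in> H" using x sub by blast
  have q0: "0 \<le> q y" for y by (simp add: q_def)
  have "f xk \<le> f x" using x(2) r by simp
  then have fx: "W - \<epsilon> < f x" using xk by (simp add: f_def q_def)
  then have "\<epsilon> * q x < \<epsilon> * 1" using W[OF xH] by (simp add: f_def)
  then have qx: "q x < 1" using \<epsilon> by simp
  have r2: "0 < r\<^sup>2" using r(1) by simp
  have "(norm (x - xk))\<^sup>2 < 1 * r\<^sup>2" using qx unfolding q_def pos_divide_less_eq[OF r2] .
  then have "(norm (x - xk))\<^sup>2 < r\<^sup>2" unfolding mult_1_left .
  then have nx: "norm (x - xk) < r" by (rule power2_less_imp_less) (use r(1) in simp)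
  have "0 \<le> \<epsilon> * q x" by (rule mult_nonneg_nonneg[OF less_imp_le[OF \<epsilon>] q0])
  then have wx: "W - \<epsilon> < w x" using fx unfolding f_def by linarith
  have "\<bar>a \<bullet> (xk - x)\<bar> \<le> norm a * norm (xk - x)" by (rule Cauchy_Schwarz_ineq2)
  then have "\<bar>a \<bullet> xk - a \<bullet> x\<bar> < r"
    using nx by (simp only: unit mult_1_left inner_diff_right norm_minus_commute[of xk x])
  then have bs: "ball x r \<subseteq> H" using r by (intro ball_subset_H) linarith
  define p where "p = (2 / r\<^sup>2) *\<^sub>R (x - xk)"
  have expand: "(norm (x - y))\<^sup>2 / r\<^sup>2 + p \<bullet> (y - x) = q y - q x" for y
  proof -
    have "(norm (y - xk))\<^sup>2 = (norm (x - xk))\<^sup>2 + 2 * ((x - xk) \<bullet> (y - x)) + (norm (x - y))\<^sup>2"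
      using dot_norm[of "x - xk" "y - x"] norm_minus_commute[of x y] by simp
    then have "(norm (y - xk))\<^sup>2 / r\<^sup>2 = ((norm (x - xk))\<^sup>2 + 2 * ((x - xk) \<bullet> (y - x)) + (norm (x - y))\<^sup>2) / r\<^sup>2"
      by (rule arg_cong)
    then show ?thesis unfolding q_def p_def by (simp add: add_divide_distrib)
  qed
  show ?thesis
  proof (rule exI[of _ x], rule exI[of _ p], intro conjI wx nx bs ballI)
    fix y
    show "- 1 \<le> (norm (x - y))\<^sup>2 / r\<^sup>2 + p \<bullet> (y - x)"
      unfolding expand using q0[of y] qx by linarith
  next
    fix y assume y: "y \<in> ball x r"
    show "w y - w x \<le> \<epsilon> * ((norm (x - y))\<^sup>2 / r\<^sup>2 + p \<bullet> (y - x))"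
    proof (cases "y \<in> cball xk r")
      case True
      then show ?thesis using x(2)[OF True] unfolding expand f_def by (simp add: algebra_simps)
    next
      case False
      then have "r\<^sup>2 \<le> (norm (y - xk))\<^sup>2" using r(1) by (intro power_mono) (auto simp: dist_norm norm_minus_commute)
      then have "1 \<le> q y" unfolding q_def pos_le_divide_eq[OF r2] mult_1_left .
      then have "\<epsilon> * 1 \<le> \<epsilon> * q y" using \<epsilon> by (intro mult_left_mono) auto
      moreover have "w y \<le> W" using W y bs by blast
      ultimately show ?thesis using fx unfolding expand f_def by (simp add: algebra_simps)
    qed
  next
    fix y assume "y \<in> H"
    then show "w y - w x \<le> \<epsilon>" using W[of y] wx by linarith
  qed
qed

text \<open>The penalised maximiser for a small \<open>\<epsilon>\<close> violates the inequality \<open>K l + \<delta> w x \<le> 0\<close>. The radius is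
  half the distance \<open>d\<close> of \<open>xk\<close> to the hyperplane, capped at \<open>r0\<close>. If the
  cap is inactive, the mass of the mirrored kernel gives \<open>l \<ge> 0\<close>; if it is active,
  \<open>l \<ge> -\<epsilon> A r0^(-2s)\<close>, which \<open>\<delta> w x\<close> outweighs.\<close>
lemma weak_maximum_principle:
  fixes w :: "'a \<Rightarrow> real"
  assumes w: "w \<in> borel_measurable lebesgue" and M: "\<And>y. \<bar>w y\<bar> \<le> M"
    and anti: "\<And>y. w (mirror y) = - w y"
    and cont: "continuous_on H w"
    and K: "K > 0" and \<delta>: "\<delta> > 0"
    and eq: "\<And>x. x \<in> H \<Longrightarrow> 0 < w x \<Longrightarrow>
      \<exists>l. ((\<lambda>\<eta>. LINT y:- ball x \<eta>|lebesgue. (w x - w y) * \<kappa> (x - y)) \<longlongrightarrow> l) (at_right 0) \<and> K * l + \<delta> * w x \<le> 0"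
    and z: "z \<in> H"
  shows "w z \<le> 0"
proof (rule ccontr)
  assume "\<not> w z \<le> 0"
  define W where "W = Sup (w ` H)"
  have bdd: "bdd_above (w ` H)" using M by (intro bdd_aboveI[of _ M]) (auto simp: abs_le_iff)
  have le_W: "w y \<le> W" if "y \<in> H" for y unfolding W_def using that by (intro cSup_upper bdd) auto
  have le_W': "\<forall>y\<in>H. w y \<le> W" by (rule ballI, rule le_W)
  have W: "W > 0" using le_W[OF z] \<open>\<not> w z \<le> 0\<close> by linarith
  obtain A where A: "A > 0" "\<forall>r>0. \<forall>x::'a.
     integrable lebesgue (\<lambda>y. min 1 ((norm (x - y))\<^sup>2 / r\<^sup>2) * \<kappa> (x - y)) \<and>
     (LINT y|lebesgue. min 1 ((norm (x - y))\<^sup>2 / r\<^sup>2) * \<kappa> (x - y)) \<le> A * r powr (- (2 * s))"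
    using rel_kernel_truncated_integral[OF s m, where 'a='a] by (elim exE conjE) (rule that)
  obtain c where c: "c > 0" "\<forall>x r. 0 < r \<longrightarrow> r \<le> a \<bullet> x - b \<longrightarrow> a \<bullet> x - b \<le> 3 * r \<longrightarrow> 9 * m * r \<le> 1 \<longrightarrow>
     c * r powr (- (2 * s)) \<le> (LINT y|lebesgue. indicat_real (H - ball x r) y * \<kappa> (x - mirror y))"
    using mirror_kernel_mass by (elim exE conjE) (rule that)
  \<comment> \<open>The largest radius at which the lower bound on the mass of the mirrored kernel is available.\<close>
  define r0 where "r0 = 1 / (9 * m)"
  have r0: "r0 > 0" using m by (simp add: r0_def)
  define B where "B = A * r0 powr (- (2 * s))"
  have B: "B > 0" using A r0 by (simp add: B_def)
  \<comment> \<open>The three bounds serve \<open>w x \<ge> W/2\<close> at the maximiser, points near the hyperplane, and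
    points far from it.\<close>
  define \<epsilon> where "\<epsilon> = min (W / 2) (min (W * c / A) (\<delta> * W / (4 * K * B)))"
  have \<epsilon>: "\<epsilon> > 0" using W c A K \<delta> B by (simp add: \<epsilon>_def)
  have \<epsilon>1: "\<epsilon> \<le> W / 2" unfolding \<epsilon>_def by (rule min.cobounded1)
  have "\<epsilon> \<le> W * c / A" unfolding \<epsilon>_def by (meson min.cobounded1 min.coboundedI2)
  then have \<epsilon>2: "\<epsilon> * A \<le> W * c" using A by (simp add: field_simps)
  have "\<epsilon> \<le> \<delta> * W / (4 * K * B)" unfolding \<epsilon>_def by (meson min.cobounded2 min.coboundedI2)
  then have \<epsilon>3: "4 * (K * (\<epsilon> * B)) \<le> \<delta> * W" using K B by (simp add: field_simps)
  have "\<exists>v\<in>w ` H. W - \<epsilon> < v"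
    using less_cSup_iff[OF _ bdd, of "W - \<epsilon>"] z \<epsilon> unfolding W_def by auto
  then obtain xk where xk: "xk \<in> H" "W - \<epsilon> < w xk" by auto
  define d where "d = a \<bullet> xk - b"
  have d: "d > 0" using xk(1) by (simp add: d_def H_def)
  have dxk: "a \<bullet> xk = d + b" by (simp add: d_def)
  define r where "r = min (d / 2) r0"
  have r: "0 < r" "2 * r \<le> a \<bullet> xk - b" 
  proof -
    show "0 < r" using d r0 by (simp add: r_def)
    have "r \<le> d / 2" unfolding r_def by (rule min.cobounded1)
    then have "2 * r \<le> d" by linarith
    then show "2 * r \<le> a \<bullet> xk - b" unfolding d_def .
  qed
  obtain x p where x: "W - \<epsilon> < w x" "norm (x - xk) < r" "ball x r \<subseteq> H"
    "\<forall>y\<in>ball x r. - 1 \<le> (norm (x - y))\<^sup>2 / r\<^sup>2 + p \<bullet> (y - x)"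
    "\<forall>y\<in>ball x r. w y - w x \<le> \<epsilon> * ((norm (x - y))\<^sup>2 / r\<^sup>2 + p \<bullet> (y - x))"
    "\<forall>y\<in>H. w y - w x \<le> \<epsilon>"
    using penalised_maximum[OF cont le_W' xk \<epsilon> r] by (elim exE conjE) (rule that)
  have xH: "x \<in> H" using x(3) r(1) by auto
  have wx: "W / 2 \<le> w x" "0 < w x" using x(1) \<epsilon>1 W by linarith+
  obtain l where l: "((\<lambda>\<eta>. LINT y:- ball x \<eta>|lebesgue. (w x - w y) * \<kappa> (x - y)) \<longlongrightarrow> l) (at_right 0)"
    "K * l + \<delta> * w x \<le> 0" using eq[OF xH wx(2)] by (elim exE conjE) (rule that)
  have Ax: "(LINT y|lebesgue. min 1 ((norm (x - y))\<^sup>2 / r\<^sup>2) * \<kappa> (x - y)) \<le> A * r powr (- (2 * s))"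
    by (rule conjunct2[OF A(2)[rule_format, OF r(1)]])
  let ?G = "LINT y|lebesgue. indicat_real (H - ball x r) y * \<kappa> (x - mirror y)"
  have l_ge: "2 * w x * ?G - \<epsilon> * (A * r powr (- (2 * s))) \<le> l"
    by (rule principal_value_near_max[OF xH w M anti r(1) x(3) less_imp_le[OF \<epsilon>] less_imp_le[OF wx(2)] x(4)[rule_format] x(5)[rule_format] x(6)[rule_format] Ax l(1)])
  have G0: "0 \<le> ?G" by (intro integral_nonneg_AE AE_I2) (simp add: rel_kernel_nonneg)
  have "- (K * l) < \<delta> * w x"
  proof (cases "d / 2 \<le> r0")
    case True
    then have rd: "r = d / 2" "r \<le> r0" by (simp_all add: r_def)
    have "\<bar>a \<bullet> (x - xk)\<bar> \<le> norm a * norm (x - xk)" by (rule Cauchy_Schwarz_ineq2)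
    then have "\<bar>a \<bullet> x - a \<bullet> xk\<bar> < r" using x(2) by (simp only: unit mult_1_left inner_diff_right)
    then have "r \<le> a \<bullet> x - b" "a \<bullet> x - b \<le> 3 * r" using rd dxk by linarith+
    moreover have "9 * m * r \<le> 1" using rd(2) m by (simp add: r0_def field_simps)
    ultimately have "c * r powr (- (2 * s)) \<le> ?G" by (rule c(2)[rule_format, OF r(1)])
    then have "W * (c * r powr (- (2 * s))) \<le> 2 * w x * ?G"
      using wx W G0 c(1) by (intro mult_mono) auto
    moreover have "\<epsilon> * A * r powr (- (2 * s)) \<le> W * c * r powr (- (2 * s))"
      using \<epsilon>2 by (intro mult_right_mono) auto
    ultimately have "0 \<le> l" using l_ge by (simp add: mult.assoc)
    then have "0 \<le> K * l" using K by simp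
    moreover have "0 < \<delta> * w x" using \<delta> wx by simp
    ultimately show ?thesis by linarith
  next
    case False
    then have r_eq: "r = r0" by (simp add: r_def)
    have "0 \<le> 2 * w x * ?G" using G0 wx(2) by (intro mult_nonneg_nonneg) auto
    then have "- (\<epsilon> * (A * r powr (- (2 * s)))) \<le> l" using l_ge by linarith
    then have "- (\<epsilon> * B) \<le> l" unfolding B_def r_eq .
    then have "K * - (\<epsilon> * B) \<le> K * l" using K by (intro mult_left_mono) auto
    moreover have "\<delta> * (W / 2) \<le> \<delta> * w x" using wx \<delta> by (intro mult_left_mono) auto
    moreover have "0 < \<delta> * W" using \<delta> W by simp
    ultimately show ?thesis using \<epsilon>3 unfolding mult_minus_right by linarith
  qed
  then show False using l(2) by linarith
qed

section \<open>The maximum principle for the operator\<close>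

text \<open>\<open>Lim\<close> denotes the limit only when there is one, so this is what gives the operator its meaning at
  points of the half-space.\<close>
lemma C11_principal_value_exists:
  fixes w :: "'a \<Rightarrow> real"
  assumes w: "w \<in> borel_measurable lebesgue" and M: "\<And>y. \<bar>w y\<bar> \<le> M"
    and C11: "w \<in> C11_loc H" and x: "x \<in> H"
  shows "((\<lambda>\<eta>. LINT y:- ball x \<eta>|lebesgue. (w x - w y) * \<kappa> (x - y)) \<longlongrightarrow>
     principal_value x (\<lambda>y. (w x - w y) * \<kappa> (x - y))) (at_right 0)"
proof -
  obtain p r L where r: "r > 0" "ball x r \<subseteq> H"
    "\<forall>y\<in>ball x r. \<bar>w x - w y + p \<bullet> (y - x)\<bar> \<le> L * (norm (x - y))\<^sup>2"
    using C11_quadratic_remainder[OF open_H C11 x] by (elim exE conjE) (rule that)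
  obtain l where l: "((\<lambda>\<eta>. LINT y:- ball x \<eta>|lebesgue. (w x - w y) * \<kappa> (x - y)) \<longlongrightarrow> l) (at_right 0)"
    by (rule rel_kernel_principal_value_exists[OF s m r(1) w M r(3)[rule_format]])
  moreover have "principal_value x (\<lambda>y. (w x - w y) * \<kappa> (x - y)) = l"
    unfolding principal_value_def by (rule tendsto_Lim[OF _ l]) simp
  ultimately show ?thesis by simp
qed

lemma rel_frac_laplacian_eq:
  fixes w :: "'a \<Rightarrow> real"
  defines "\<nu> \<equiv> real DIM('a) / 2 + s"
  shows "rel_frac_laplacian m s w x =
    frac_const DIM('a) s * m powr \<nu> * principal_value x (\<lambda>y. (w x - w y) * \<kappa> (x - y)) + m powr (2 * s) * w x"
  by (simp add: rel_frac_laplacian_def rel_kernel_def Let_def \<nu>_def)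

lemma frac_const_pos: "0 < frac_const N s"
proof -
  have "0 < Gamma (2 - s)" using s by (intro Gamma_real_pos) simp
  then show ?thesis using s by (simp add: frac_const_def)
qed

text \<open>The two principles for a half-space with unit normal. The strict bound on the infimum of \<open>c\<close> yields a
  uniform gap \<open>\<delta>\<close> between \<open>m^(2s) + c\<close> and 0 on the set where \<open>w\<close> is positive.\<close>
lemma maximum_principle:
  fixes w :: "'a \<Rightarrow> real"
  assumes w: "w \<in> weighted_L1 s" and C11: "w \<in> C11_loc H"
    and bdd: "bdd_above (range w)"
    and anti: "\<And>y. w (mirror y) = - w y"
    and eq: "\<And>x. x \<in> H \<Longrightarrow> 0 < w x \<Longrightarrow> rel_frac_laplacian m s w x + c x * w x \<le> 0"
    and c: "ereal (- (m powr (2 * s))) < (INF x\<in>{x\<in>H. 0 < w x}. ereal (c x))"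
  shows "(\<forall>x\<in>H. w x \<le> 0) \<and>
    ((\<forall>x\<in>H. w x = 0 \<longrightarrow> rel_frac_laplacian m s w x \<le> 0) \<longrightarrow> (\<forall>x\<in>H. w x < 0) \<or> (\<forall>x. w x = 0))"
proof -
  define K where "K = frac_const DIM('a) s * m powr (real DIM('a) / 2 + s)"
  have K: "K > 0" using frac_const_pos m by (simp add: K_def)
  have w_m: "w \<in> borel_measurable lebesgue" using w by (simp add: weighted_L1_def)
  have cont: "continuous_on H w" by (rule continuous_on_C11_loc[OF C11])
  obtain M where M0: "\<And>y. w y \<le> M" using bdd by (auto simp: bdd_above_def)
  have M: "\<bar>w y\<bar> \<le> M" for y using M0[of y] M0[of "mirror y"] anti[of y] by (simp add: abs_le_iff)
  note pv = C11_principal_value_exists[OF w_m M C11]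
  obtain t where t: "ereal (- (m powr (2 * s))) < ereal t" "ereal t < (INF x\<in>{x\<in>H. 0 < w x}. ereal (c x))"
    using ereal_dense2[OF c] by blast
  define \<delta> where "\<delta> = m powr (2 * s) + t"
  have \<delta>: "\<delta> > 0" using t(1) by (simp add: \<delta>_def)
  have c_ge: "t \<le> c x" if "x \<in> H" "0 < w x" for x
  proof -
    have "(INF x\<in>{x\<in>H. 0 < w x}. ereal (c x)) \<le> ereal (c x)"
      using that by (intro INF_lower) auto
    then have "ereal t < ereal (c x)" using t(2) by (rule less_le_trans[rotated])
    then show ?thesis by simp
  qed
  have le0: "w x \<le> 0" if "x \<in> H" for x
  proof (rule weak_maximum_principle[OF w_m M anti cont K \<delta> _ that])
    fix x assume x: "x \<in> H" "0 < w x"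
    let ?l = "principal_value x (\<lambda>y. (w x - w y) * \<kappa> (x - y))"
    have "K * ?l + m powr (2 * s) * w x + c x * w x \<le> 0"
      using eq[OF x] unfolding rel_frac_laplacian_eq K_def .
    moreover have "t * w x \<le> c x * w x" using c_ge[OF x] x(2) by (intro mult_right_mono) auto
    ultimately have "K * ?l + \<delta> * w x \<le> 0" unfolding \<delta>_def distrib_right by linarith
    with pv[OF x(1)]
    show "\<exists>l. ((\<lambda>\<eta>. LINT y:- ball x \<eta>|lebesgue. (w x - w y) * \<kappa> (x - y)) \<longlongrightarrow> l) (at_right 0) \<and> K * l + \<delta> * w x \<le> 0"
      by (intro exI conjI)
  qed
  have "(\<forall>x\<in>H. w x < 0) \<or> (\<forall>x. w x = 0)"
    if zero: "\<forall>x\<in>H. w x = 0 \<longrightarrow> rel_frac_laplacian m s w x \<le> 0"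
  proof (cases "\<exists>x\<in>H. w x = 0")
    case False
    then have "w x < 0" if "x \<in> H" for x using le0[OF that] that by fastforce
    then show ?thesis by blast
  next
    case True
    then obtain x where x: "x \<in> H" "w x = 0" by blast
    then have "rel_frac_laplacian m s w x \<le> 0" using zero by blast
    then have "K * principal_value x (\<lambda>y. (w x - w y) * \<kappa> (x - y)) \<le> 0"
      unfolding rel_frac_laplacian_eq K_def x(2) by simp
    then have l0: "principal_value x (\<lambda>y. (w x - w y) * \<kappa> (x - y)) \<le> 0"
      using K by (simp only: mult_le_0_iff) linarith
    have "w y = 0" for y
      by (rule strong_maximum_principle[OF w_m M anti cont _ x pv[OF x(1)] l0]) (rule le0)
    then show ?thesis by blast
  qed
  with le0 show ?thesis by blast
qed

end

theorem theorem2p8: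
  fixes m s b :: real
    and a :: "'a::euclidean_space"
    and T \<Sigma> :: "'a set"
    and w c :: "'a \<Rightarrow> real"
  assumes "0 < s" "s < 1" and "m > 0"
    and "a \<noteq> 0" and "T = {x. a \<bullet> x = b}"
    and "\<Sigma> = {x. a \<bullet> x < b} \<or> \<Sigma> = {x. a \<bullet> x > b}"
    and "w \<in> weighted_L1 s \<inter> C11_loc \<Sigma>"
    and "bdd_above (range w)"
    and "\<And>x. w (reflection T x) = - w x"
    and "\<And>x. x \<in> \<Sigma> \<Longrightarrow> w x > 0 \<Longrightarrow> rel_frac_laplacian m s w x + c x * w x \<le> 0"
    and "(INF x\<in>{x\<in>\<Sigma>. w x > 0}. ereal (c x)) > ereal (- (m powr (2 * s)))"
  shows "(\<forall>x\<in>\<Sigma>. w x \<le> 0) \<and>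
    ((\<forall>x\<in>\<Sigma>. w x = 0 \<longrightarrow> rel_frac_laplacian m s w x \<le> 0) \<longrightarrow>
       (\<forall>x\<in>\<Sigma>. w x < 0) \<or> (\<forall>x. w x = 0))"
proof -
  \<comment> \<open>The sign orients the unit normal into \<open>\<Sigma>\<close>.\<close>
  define \<sigma> :: real where "\<sigma> = (if \<Sigma> = {x. a \<bullet> x > b} then 1 else - 1)"
  define n where "n = (\<sigma> / norm a) *\<^sub>R a"
  define h where "h = \<sigma> / norm a * b"
  have na: "norm a > 0" using assms(4) by simp
  have \<sigma>: "\<bar>\<sigma>\<bar> = 1" "\<sigma> * \<sigma> = 1" by (simp_all add: \<sigma>_def)
  interpret rel_half_space n h m s
  proof
    show "norm n = 1" unfolding n_def norm_scaleR using na \<sigma> by simp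
  qed (use assms(1-3) in auto)
  have n_inner: "n \<bullet> y - h = \<sigma> / norm a * (a \<bullet> y - b)" for y
    by (simp add: n_def h_def right_diff_distrib)
  have side: "h < n \<bullet> y \<longleftrightarrow> 0 < \<sigma> * (a \<bullet> y - b)" for y
  proof -
    have "h < n \<bullet> y \<longleftrightarrow> 0 < n \<bullet> y - h" by simp
    also have "n \<bullet> y - h = \<sigma> * (a \<bullet> y - b) / norm a" unfolding n_inner by simp
    finally show ?thesis unfolding zero_less_divide_iff using na by auto
  qed
  have "\<Sigma> = H"
  proof (cases "\<Sigma> = {x. a \<bullet> x > b}")
    case True
    then have "\<sigma> = 1" by (simp add: \<sigma>_def)
    then show ?thesis using True unfolding H_def side by simp
  next
    case False
    then have "\<Sigma> = {x. a \<bullet> x < b}" "\<sigma> = - 1" using assms(6) by (auto simp: \<sigma>_def)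
    then show ?thesis unfolding H_def side by simp
  qed
  have "mirror y = reflection T y" for y
  proof -
    have "(2 * (n \<bullet> y - h)) *\<^sub>R n = (\<sigma> * \<sigma> * (2 * (a \<bullet> y - b) / (norm a * norm a))) *\<^sub>R a"
    proof -
      have "2 * (\<sigma> / N * t) * (\<sigma> / N) = \<sigma> * \<sigma> * (2 * t / (N * N))" for N t :: real
        by (simp add: mult_ac)
      then show ?thesis unfolding n_inner unfolding n_def scaleR_scaleR by simp
    qed
    also have "norm a * norm a = a \<bullet> a" by (simp add: power2_norm_eq_inner flip: power2_eq_square)
    finally show ?thesis
      unfolding mirror_def assms(5) reflection_hyperplane[OF assms(4)] \<sigma>(2) by simp
  qed
  then have anti: "w (mirror y) = - w y" for y using assms(9) by simp
  show ?thesis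
    using maximum_principle[of w c] assms(7,8,10,11) anti unfolding \<open>\<Sigma> = H\<close> by blast
qed

end
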